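(* Let $\mathcal{H}_1,\dots,\mathcal{H}_N$ be finite-dimensional complex Hilbert spaces and $\mathcal{H}=\mathcal{H}_1\otimes\cdots\otimes\mathcal{H}_N$. Let $S$ be an unextendible product basis in $\mathcal{H}$, let $P_S$ be the orthogonal projector onto the span of $S$, let $P_S^\perp=\mathbf{1}-P_S$, and let $\varrho_{UPB}=P_S^\perp/\mathrm{Tr}(P_S^\perp)$. Let $C\ge 0$ be an arbitrary positive operator on $\mathcal{H}$ with $\mathrm{Tr}(P_S^\perp C)\ge 0$, and put $$\epsilon=\min_{P_1\otimes\cdots\otimes P_N}\mathrm{Tr}\big(P_S\,P_1\otimes\cdots\otimes P_N\big),\qquad c=\max_{P_1\otimes\cdots\otimes P_N}\mathrm{Tr}\big(C\,P_1\otimes\cdots\otimes P_N\big),$$ where the $P_i$ range over the rank-one projectors on $\mathcal{H}_i$. Define $$\tilde A=P_S-\frac{\epsilon}{c}\,C .$$ Then: (1) $\tilde A$ has nonnegative mean values on product states, i.e. $\mathrm{Tr}(\tilde A\,P_1\otimes\cdots\otimes P_N)\ge 0$ for all rank-one projectors $P_i$ on $\mathcal{H}_i$, while $$\mathrm{Tr}(\tilde A\,\varrho_{UPB})=-\frac{\epsilon}{c}<0 ,$$ so that $\tilde A$ is an entanglement witness for $\varrho_{UPB}$. (2) The linear map $\Lambda_{\tilde A}:\mathcal{B}(\mathcal{H}_2\otimes\cdots\otimes\mathcal{H}_N)\to\mathcal{B}(\mathcal{H}_1)$ corresponding to $\tilde A$ via $\tilde A=(I\otimes\Lambda_{\tilde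 A}^\dagger)(|\Psi\rangle\langle\Psi|)$ is positive on product states, i.e. $\Lambda_{\tilde A}(P_2\otimes\cdots\otimes P_N)\ge 0$ for all projectors $P_i$ on $\mathcal{H}_i$, and it detects the entanglement of $\varrho_{UPB}$, since $$\langle\Psi|\,(I\otimes\Lambda_{\tilde A})(\varrho_{UPB})\,|\Psi\rangle=\mathrm{Tr}(\tilde A\,\varrho_{UPB})<0 .$$
   Context: $\mathcal{B}(\mathcal{H})$ denotes the algebra of all operators on $\mathcal{H}$; $X\ge 0$ ("positive") means that $X$ is Hermitian with nonnegative eigenvalues. An unextendible product basis in $\mathcal{H}_1\otimes\cdots\otimes\mathcal{H}_N$ is a set $S$ of product vectors $v_1\otimes\cdots\otimes v_N$ such that (i) there is no product vector orthogonal to all elements of $S$, and (ii) $S$ does not span $\mathcal{H}$. A state (positive operator of trace one) on $\mathcal{H}$ is separable if it is a convex combination of product states $\varrho^1\otimes\cdots\otimes\varrho^N$, and entangled otherwise. An observable is an entanglement witness if its mean value is nonnegative on all separable states; it is a witness for a given state if in addition its mean value on that state is negative. The vector $|\Psi\rangle=\sum_{k=1}^{\dim\mathcal{H}_1}|k\rangle\otimes|k\rangle\in\mathcal{H}_1\otimes\mathcal{H}_1$ is the unnormalized maximally entangled vector in a fixed orthonormal basis $\{|k\rangle\}$ of $\mathcal{H}_1$. $I$ is the identity map on $\mathcal{B}(\mathcal{H}_1)$, and $\Lambda^\dagger:\mathcal{B}(\mathcal{H}_1)\to\mathcal{B}(\mathcal{H}_2\otimes\cdots\otimes\mathcal{H}_N)$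 is the adjoint of $\Lambda$ with respect to the Hilbert–Schmidt inner product $\langle X,Y\rangle=\mathrm{Tr}(X^\dagger Y)$.
   Formalization: The mean value on ρ_UPB is stated as −(ε/c)Tr(Cρ_UPB), which is −ε/c when Tr(Cρ_UPB)=1; strict negativity, the witness claim and detection are stated for Tr(P_S^⊥C)>0, since for C=P_S the printed hypothesis holds but the mean value is 0. *)

theory Defs
  imports
    "Jordan_Normal_Form.Schur_Decomposition"
    "Jordan_Normal_Form.DL_Rank"
    "HOL-Library.FuncSet"
begin

text \<open>
  Finite-dimensional Hilbert spaces are coordinatised: a space of dimension \<open>d\<close> is
  \<open>carrier_vec d\<close> over the complex numbers with inner product
  \<open>\<langle>w|v\<rangle> = v \<bullet>c w\<close>, and its operators are \<open>carrier_mat d d\<close>.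
  A list \<open>ds = [d\<^sub>1, \<dots>, d\<^sub>N]\<close> of local dimensions stands for the tensor product of the spaces of
  dimensions \<open>d\<^sub>1, \<dots>, d\<^sub>N\<close>, realised by Kronecker products on dimension \<open>prod_list ds\<close>.
  Inequalities between complex numbers are those of \<open>HOL-Library.Complex_Order\<close>: \<open>0 \<le> z\<close>
  says that \<open>z\<close> is real and nonnegative.
\<close>

definition mat_trace :: "complex mat \<Rightarrow> complex" where
  "mat_trace A = (\<Sum>i<dim_row A. A $$ (i, i))"

definition hermitian_op :: "nat \<Rightarrow> complex mat \<Rightarrow> bool" where
  "hermitian_op n A \<longleftrightarrow> A \<in> carrier_mat n n \<and> mat_adjoint A = A"

definition positive_op :: "nat \<Rightarrow> complex mat \<Rightarrow> bool" where
  "positive_op n A \<longleftrightarrow> hermitian_op n A \<and> (\<forall>k. eigenvalue A k \<longrightarrow> 0 \<le> k)"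

definition density_op :: "nat \<Rightarrow> complex mat \<Rightarrow> bool" where
  "density_op n A \<longleftrightarrow> positive_op n A \<and> mat_trace A = 1"

definition orth_projector :: "nat \<Rightarrow> complex mat \<Rightarrow> bool" where
  "orth_projector n P \<longleftrightarrow> hermitian_op n P \<and> P * P = P"

definition orth_projector_onto :: "nat \<Rightarrow> complex vec set \<Rightarrow> complex mat \<Rightarrow> bool" where
  "orth_projector_onto n W P \<longleftrightarrow> orth_projector n P \<and> (\<lambda>v. P *\<^sub>v v) ` carrier_vec n = W"

definition rank1_projector :: "nat \<Rightarrow> complex mat \<Rightarrow> bool" where
  "rank1_projector n P \<longleftrightarrow> orth_projector n P \<and> vec_space.rank n P = 1"

definition vec_span :: "nat \<Rightarrow> complex vec set \<Rightarrow> complex vec set" where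
  "vec_span n S = LinearCombinations.module.span class_ring (module_vec TYPE(complex) n) S"

definition kron_mat :: "complex mat \<Rightarrow> complex mat \<Rightarrow> complex mat" where
  "kron_mat A B = mat (dim_row A * dim_row B) (dim_col A * dim_col B)
     (\<lambda>(i, j). A $$ (i div dim_row B, j div dim_col B) * B $$ (i mod dim_row B, j mod dim_col B))"

definition kron_vec :: "complex vec \<Rightarrow> complex vec \<Rightarrow> complex vec" where
  "kron_vec v w = vec (dim_vec v * dim_vec w) (\<lambda>i. v $ (i div dim_vec w) * w $ (i mod dim_vec w))"

definition tensor_mat :: "complex mat list \<Rightarrow> complex mat" where
  "tensor_mat As = foldr kron_mat As (1\<^sub>m 1)"

definition tensor_vec :: "complex vec list \<Rightarrow> complex vec" where
  "tensor_vec vs = foldr kron_vec vs (vec 1 (\<lambda>_. 1))"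

text \<open>Product vectors are nonzero; otherwise no set could be unextendible.\<close>

definition product_vector :: "nat list \<Rightarrow> complex vec \<Rightarrow> bool" where
  "product_vector ds v \<longleftrightarrow>
     (\<exists>vs. list_all2 (\<lambda>d u. u \<in> carrier_vec d \<and> u \<noteq> 0\<^sub>v d) ds vs \<and> v = tensor_vec vs)"

definition unextendible_product_basis :: "nat list \<Rightarrow> complex vec set \<Rightarrow> bool" where
  "unextendible_product_basis ds S \<longleftrightarrow>
     (\<forall>v\<in>S. product_vector ds v) \<and>
     \<not> (\<exists>v. product_vector ds v \<and> (\<forall>w\<in>S. v \<bullet>c w = 0)) \<and>
     vec_span (prod_list ds) S \<noteq> carrier_vec (prod_list ds)"

definition separable :: "nat list \<Rightarrow> complex mat \<Rightarrow> bool" where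
  "separable ds \<sigma> \<longleftrightarrow>
     (\<exists>(n::nat) (p :: nat \<Rightarrow> real) (R :: nat \<Rightarrow> complex mat list).
        (\<forall>k<n. 0 \<le> p k \<and> list_all2 density_op ds (R k)) \<and> (\<Sum>k<n. p k) = 1 \<and>
        \<sigma> = mat (prod_list ds) (prod_list ds)
              (\<lambda>(i, j). \<Sum>k<n. complex_of_real (p k) * tensor_mat (R k) $$ (i, j)))"

definition entangled :: "nat list \<Rightarrow> complex mat \<Rightarrow> bool" where
  "entangled ds \<sigma> \<longleftrightarrow> density_op (prod_list ds) \<sigma> \<and> \<not> separable ds \<sigma>"

definition entanglement_witness :: "nat list \<Rightarrow> complex mat \<Rightarrow> bool" where
  "entanglement_witness ds A \<longleftrightarrow> hermitian_op (prod_list ds) A \<and>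
     (\<forall>\<sigma>. separable ds \<sigma> \<longrightarrow> 0 \<le> mat_trace (A * \<sigma>))"

definition entanglement_witness_for :: "nat list \<Rightarrow> complex mat \<Rightarrow> complex mat \<Rightarrow> bool" where
  "entanglement_witness_for ds A \<sigma> \<longleftrightarrow> entanglement_witness ds A \<and>
     density_op (prod_list ds) \<sigma> \<and> mat_trace (A * \<sigma>) < 0"

text \<open>Only used for Hermitian \<open>A\<close>, for which the traces are real, so that taking the real part
  merely changes the type.\<close>

definition product_values :: "nat list \<Rightarrow> complex mat \<Rightarrow> real set" where
  "product_values ds A =
     {Re (mat_trace (A * tensor_mat Ps)) |Ps. list_all2 rank1_projector ds Ps}"

text \<open>Linear maps from operators in dimension \<open>m\<close> to operators in dimension \<open>n\<close>, extensional
  so that equality of maps is equality of functions.\<close>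

definition linear_superop :: "nat \<Rightarrow> nat \<Rightarrow> (complex mat \<Rightarrow> complex mat) \<Rightarrow> bool" where
  "linear_superop m n M \<longleftrightarrow> M \<in> carrier_mat m m \<rightarrow>\<^sub>E carrier_mat n n \<and>
     (\<forall>X\<in>carrier_mat m m. \<forall>Y\<in>carrier_mat m m. M (X + Y) = M X + M Y) \<and>
     (\<forall>a. \<forall>X\<in>carrier_mat m m. M (a \<cdot>\<^sub>m X) = a \<cdot>\<^sub>m M X)"

text \<open>\<open>M\<close> is the adjoint of \<open>L\<close> for \<open>\<langle>X, Y\<rangle> = Tr (X\<^sup>\<dagger> Y)\<close>.\<close>

definition hs_adjoint :: "nat \<Rightarrow> nat \<Rightarrow> (complex mat \<Rightarrow> complex mat) \<Rightarrow> (complex mat \<Rightarrow> complex mat) \<Rightarrow> bool" where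
  "hs_adjoint m n L M \<longleftrightarrow> linear_superop n m M \<and>
     (\<forall>X\<in>carrier_mat m m. \<forall>Y\<in>carrier_mat n n.
        mat_trace (mat_adjoint Y * L X) = mat_trace (mat_adjoint (M Y) * X))"

text \<open>\<open>id_tensor d m n M\<close> is \<open>I \<otimes> M\<close> for \<open>I\<close> the identity on operators in dimension \<open>d\<close> and
  \<open>M\<close> a map from operators in dimension \<open>m\<close> to operators in dimension \<open>n\<close>: \<open>M\<close> acts on
  each of the \<open>d * d\<close> blocks of size \<open>m\<close>. It is pinned down by the lemma \<open>id_tensor_kron\<close>.\<close>

definition id_tensor :: "nat \<Rightarrow> nat \<Rightarrow> nat \<Rightarrow> (complex mat \<Rightarrow> complex mat) \<Rightarrow> complex mat \<Rightarrow> complex mat" where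
  "id_tensor d m n M X = mat (d * n) (d * n)
     (\<lambda>(i, j). M (mat m m (\<lambda>(a, b). X $$ ((i div n) * m + a, (j div n) * m + b)))
                 $$ (i mod n, j mod n))"

lemma id_tensor_kron:
  assumes A: "A \<in> carrier_mat d d" and B: "B \<in> carrier_mat m m" and M: "linear_superop m n M"
  shows "id_tensor d m n M (kron_mat A B) = kron_mat A (M B)"
proof -
  have MB: "M B \<in> carrier_mat n n"
    using M B by (auto simp: linear_superop_def PiE_def Pi_def)
  have block: "mat m m (\<lambda>(a, b). kron_mat A B $$ (k * m + a, l * m + b)) = A $$ (k, l) \<cdot>\<^sub>m B"
    if "k < d" "l < d" for k l
  proof (rule eq_matI)
    fix a b assume "a < dim_row (A $$ (k, l) \<cdot>\<^sub>m B)" "b < dim_col (A $$ (k, l) \<cdot>\<^sub>m B)"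
    then have ab: "a < m" "b < m" using B by auto
    have lt: "k * m + a < d * m" if "k < d" "a < m" for k a :: nat
    proof -
      have "k * m + a < Suc k * m" using that by simp
      also have "\<dots> \<le> d * m" using that by (intro mult_right_mono) auto
      finally show ?thesis .
    qed
    show "mat m m (\<lambda>(a, b). kron_mat A B $$ (k * m + a, l * m + b)) $$ (a, b)
        = (A $$ (k, l) \<cdot>\<^sub>m B) $$ (a, b)"
      using ab A B lt[OF that(1) ab(1)] lt[OF that(2) ab(2)] by (simp add: kron_mat_def)
  qed (use B in auto)
  have smult: "M (a \<cdot>\<^sub>m B) = a \<cdot>\<^sub>m M B" for a
    using M B by (auto simp: linear_superop_def)
  show ?thesis
  proof (rule eq_matI)
    fix i j assume "i < dim_row (kron_mat A (M B))" "j < dim_col (kron_mat A (M B))"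
    then have ij: "i < d * n" "j < d * n" using A MB by (auto simp: kron_mat_def)
    then have "n > 0" by (cases n) auto
    then have "i mod n < n" "j mod n < n" "i div n < d" "j div n < d"
      using ij by (auto simp: less_mult_imp_div_less)
    then show "id_tensor d m n M (kron_mat A B) $$ (i, j) = kron_mat A (M B) $$ (i, j)"
      using ij A MB block smult by (simp add: id_tensor_def kron_mat_def[of A "M B"])
  qed (use A MB in \<open>auto simp: id_tensor_def kron_mat_def\<close>)
qed

definition orthonormal_basis :: "nat \<Rightarrow> (nat \<Rightarrow> complex vec) \<Rightarrow> bool" where
  "orthonormal_basis d e \<longleftrightarrow> (\<forall>k<d. e k \<in> carrier_vec d) \<and>
     (\<forall>k<d. \<forall>l<d. e k \<bullet>c e l = (if k = l then 1 else 0))"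

definition max_entangled_vec :: "nat \<Rightarrow> (nat \<Rightarrow> complex vec) \<Rightarrow> complex vec" where
  "max_entangled_vec d e = vec (d * d) (\<lambda>i. \<Sum>k<d. kron_vec (e k) (e k) $ i)"

definition ket_bra :: "complex vec \<Rightarrow> complex mat" where
  "ket_bra v = mat (dim_vec v) (dim_vec v) (\<lambda>(i, j). v $ i * cnj (v $ j))"

definition expval :: "complex vec \<Rightarrow> complex mat \<Rightarrow> complex" where
  "expval v X = (X *\<^sub>v v) \<bullet>c v"

text \<open>\<open>L\<close> (from operators in dimension \<open>m\<close> to operators in dimension \<open>d\<close>) corresponds to the
  operator \<open>A\<close> in dimension \<open>d * m\<close> via \<open>A = (I \<otimes> L\<^sup>\<dagger>) (|\<Psi>\<rangle>\<langle>\<Psi>|)\<close>.\<close>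

definition corresponding_map ::
  "nat \<Rightarrow> nat \<Rightarrow> (nat \<Rightarrow> complex vec) \<Rightarrow> complex mat \<Rightarrow> (complex mat \<Rightarrow> complex mat) \<Rightarrow> bool" where
  "corresponding_map d m e A L \<longleftrightarrow> linear_superop m d L \<and>
     (\<exists>Ld. hs_adjoint m d L Ld \<and> A = id_tensor d d m Ld (ket_bra (max_entangled_vec d e)))"

end

theory Submission
  imports Defs
begin

text \<open>
  Unit product vectors form a compact set, so \<open>\<epsilon>\<close> and \<open>c\<close> are attained; unextendibility
  makes \<open>\<epsilon>\<close> positive, since \<open>\<langle>v|P|v\<rangle> = 0\<close> means that \<open>v\<close> is orthogonal to \<open>S\<close>. Hence \<open>A\<close> is
  nonnegative on unit product vectors, and by decomposing every factor into rank-one positive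
  operators it is nonnegative on tensor products of arbitrary positive operators. For the map
  \<open>\<Lambda>\<close> corresponding to \<open>A\<close>, \<open>\<langle>\<phi>|\<Lambda>(Q)|\<phi>\<rangle>\<close> is \<open>Tr (A (|\<psi>\<rangle>\<langle>\<psi>| \<otimes> Q))\<close> with \<open>\<psi>\<close> a
  conjugate of \<open>\<phi>\<close>, so positivity of \<open>\<Lambda>\<close> on product operators is again that of \<open>A\<close>.
\<close>

subsection \<open>Positive semidefinite matrices\<close>

text \<open>No spectral theorem is invoked. Positivity is defined through eigenvalues, while every
  estimate concerns the quadratic form \<open>expval\<close>; elimination supplies the rank-one
  decompositions, and minimising the form supplies the eigenvalue that links the two notions. The
  compactness result therefore serves twice: with a single factor it yields this eigenvalue, with
  all factors it yields \<epsilon> and c. Since \<open>e\<close> is an arbitrary orthonormal basis,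
  the coordinates of \<Psi> form the matrix G = E E^T instead of the identity. The correspondence is
  the usual Choi one up to conjugation by G, and all facts about it reduce to G being symmetric and
  unitary. One explicit formula, \<open>choi_map\<close>, gives existence and uniqueness together,
  so positivity and detection are checked for that formula alone. The degenerate case is c = 0:
  division by zero yields 0, so A becomes P, which is nonnegative on product vectors but has mean
  value 0 on the state. It is excluded when Tr (Pperp C) > 0, because a positive operator that
  vanishes on all product vectors has trace 0 and hence is 0.\<close>

lemma cscalar_prod_sum:
  fixes v w :: "complex vec"
  assumes "v \<in> carrier_vec n" "w \<in> carrier_vec n"
  shows "v \<bullet>c w = (\<Sum>i<n. v $ i * cnj (w $ i))"
  using assms by (auto simp: scalar_prod_def lessThan_atLeast0)

lemma cscalar_prod_commute:
  fixes v w :: "complex vec"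
  assumes "v \<in> carrier_vec n" "w \<in> carrier_vec n"
  shows "w \<bullet>c v = cnj (v \<bullet>c w)"
  using assms by (simp add: cscalar_prod_sum[of _ n] mult.commute)

lemma index_mat_adjoint:
  fixes A :: "complex mat"
  assumes "A \<in> carrier_mat m n" "i < n" "j < m"
  shows "mat_adjoint A $$ (i, j) = cnj (A $$ (j, i))"
  using assms by (auto simp: mat_adjoint_def mat_of_rows_def)

lemma mat_adjoint_carrier:
  fixes A :: "complex mat"
  shows "A \<in> carrier_mat m n \<Longrightarrow> mat_adjoint A \<in> carrier_mat n m"
  by (auto simp: mat_adjoint_def)

lemma hermitian_op_iff:
  "hermitian_op n A \<longleftrightarrow> A \<in> carrier_mat n n \<and> (\<forall>i<n. \<forall>j<n. A $$ (i, j) = cnj (A $$ (j, i)))"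
proof
  assume "hermitian_op n A"
  then show "A \<in> carrier_mat n n \<and> (\<forall>i<n. \<forall>j<n. A $$ (i, j) = cnj (A $$ (j, i)))"
    unfolding hermitian_op_def by (metis index_mat_adjoint)
next
  assume R: "A \<in> carrier_mat n n \<and> (\<forall>i<n. \<forall>j<n. A $$ (i, j) = cnj (A $$ (j, i)))"
  then have A: "A \<in> carrier_mat n n" by blast
  have H: "cnj (A $$ (j, i)) = A $$ (i, j)" if "i < n" "j < n" for i j
    using R that by metis
  have "mat_adjoint A = A"
    using A mat_adjoint_carrier[OF A] by (intro eq_matI) (auto simp: index_mat_adjoint[OF A] H)
  with A show "hermitian_op n A" by (simp add: hermitian_op_def)
qed

lemma index_mult_mat_vec_sum:
  fixes A :: "complex mat"
  assumes "A \<in> carrier_mat m n" "v \<in> carrier_vec n" "i < m"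
  shows "(A *\<^sub>v v) $ i = (\<Sum>j<n. A $$ (i, j) * v $ j)"
  using assms by (auto simp: scalar_prod_def lessThan_atLeast0)

lemma expval_sum:
  assumes "A \<in> carrier_mat n n" "v \<in> carrier_vec n"
  shows "expval v A = (\<Sum>i<n. \<Sum>j<n. cnj (v $ i) * A $$ (i, j) * v $ j)"
proof -
  have "expval v A = (\<Sum>i<n. (A *\<^sub>v v) $ i * cnj (v $ i))"
    unfolding expval_def using assms by (intro cscalar_prod_sum) auto
  also have "\<dots> = (\<Sum>i<n. (\<Sum>j<n. A $$ (i, j) * v $ j) * cnj (v $ i))"
    by (intro sum.cong refl) (simp only: lessThan_iff index_mult_mat_vec_sum[OF assms])
  also have "\<dots> = (\<Sum>i<n. \<Sum>j<n. cnj (v $ i) * A $$ (i, j) * v $ j)"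
    by (simp add: sum_distrib_left sum_distrib_right mult.commute mult.left_commute)
  finally show ?thesis .
qed

lemma mat_trace_mult:
  assumes "A \<in> carrier_mat n m" "B \<in> carrier_mat m n"
  shows "mat_trace (A * B) = (\<Sum>i<n. \<Sum>j<m. A $$ (i, j) * B $$ (j, i))"
  using assms by (auto simp: mat_trace_def scalar_prod_def lessThan_atLeast0 intro!: sum.cong)

lemma mat_trace_comm:
  assumes "A \<in> carrier_mat n m" "B \<in> carrier_mat m n"
  shows "mat_trace (A * B) = mat_trace (B * A)"
  unfolding mat_trace_mult[OF assms] mat_trace_mult[OF assms(2,1)]
  by (subst sum.swap) (simp add: mult.commute)

lemma index_ket_bra:
  "v \<in> carrier_vec n \<Longrightarrow> i < n \<Longrightarrow> j < n \<Longrightarrow> ket_bra v $$ (i, j) = v $ i * cnj (v $ j)"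
  by (auto simp: ket_bra_def)

lemma ket_bra_carrier: "v \<in> carrier_vec n \<Longrightarrow> ket_bra v \<in> carrier_mat n n"
  by (auto simp: ket_bra_def)

lemma mat_trace_mult_ket_bra:
  assumes "A \<in> carrier_mat n n" "v \<in> carrier_vec n"
  shows "mat_trace (A * ket_bra v) = expval v A"
  using assms
  by (auto simp: mat_trace_mult[OF _ ket_bra_carrier] expval_sum index_ket_bra intro!: sum.cong)

lemma expval_scaled:
  assumes "A \<in> carrier_mat n n" "v \<in> carrier_vec n"
  shows "expval (s \<cdot>\<^sub>v v) A = cnj s * s * expval v A"
proof -
  have "s \<cdot>\<^sub>v v \<in> carrier_vec n" using assms by auto
  then show ?thesis using assms
    by (simp add: expval_sum sum_distrib_left mult_ac)
qed

lemma expval_add: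
  assumes "A \<in> carrier_mat n n" "v \<in> carrier_vec n" "w \<in> carrier_vec n"
  shows "expval (v + w) A = expval v A + expval w A + (A *\<^sub>v v) \<bullet>c w + (A *\<^sub>v w) \<bullet>c v"
proof -
  have c: "v + w \<in> carrier_vec n" "A *\<^sub>v v \<in> carrier_vec n" "A *\<^sub>v w \<in> carrier_vec n"
    using assms by auto
  have "A *\<^sub>v (v + w) = A *\<^sub>v v + A *\<^sub>v w" using assms by (intro mult_add_distrib_mat_vec)
  then show ?thesis unfolding expval_def using assms c
    by (simp add: cscalar_prod_sum[of _ n] ring_distribs sum.distrib)
qed

text \<open>No symmetry is demanded: \<open>0 \<le>\<close> on complex numbers contains reality of
  the form, and over the complex numbers that already forces the matrix to be Hermitian.\<close>

definition psd :: "nat \<Rightarrow> complex mat \<Rightarrow> bool" where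
  "psd n A \<longleftrightarrow> A \<in> carrier_mat n n \<and> (\<forall>v\<in>carrier_vec n. 0 \<le> expval v A)"

lemma mult_smult_unit_vec:
  fixes A :: "complex mat"
  assumes "A \<in> carrier_mat n n" "k < n" "i < n"
  shows "(A *\<^sub>v (s \<cdot>\<^sub>v unit_vec n k)) $ i = s * A $$ (i, k)"
proof -
  have "(A *\<^sub>v (s \<cdot>\<^sub>v unit_vec n k)) $ i = (\<Sum>j<n. A $$ (i, j) * (s \<cdot>\<^sub>v unit_vec n k) $ j)"
    using assms by (intro index_mult_mat_vec_sum) auto
  also have "\<dots> = (\<Sum>j<n. if j = k then s * A $$ (i, k) else 0)"
    using assms by (intro sum.cong) auto
  finally show ?thesis using assms by simp
qed

lemma cscalar_prod_smult_unit_vec: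
  fixes v :: "complex vec"
  assumes "v \<in> carrier_vec n" "k < n"
  shows "v \<bullet>c (s \<cdot>\<^sub>v unit_vec n k) = cnj s * v $ k"
proof -
  have "v \<bullet>c (s \<cdot>\<^sub>v unit_vec n k) = (\<Sum>j<n. v $ j * cnj ((s \<cdot>\<^sub>v unit_vec n k) $ j))"
    using assms by (intro cscalar_prod_sum) auto
  also have "\<dots> = (\<Sum>j<n. if j = k then cnj s * v $ k else 0)"
    using assms by (intro sum.cong) auto
  finally show ?thesis using assms by simp
qed

lemma expval_unit_vec:
  assumes "A \<in> carrier_mat n n" "k < n"
  shows "expval (unit_vec n k) A = A $$ (k, k)"
proof -
  have "A *\<^sub>v unit_vec n k \<in> carrier_vec n" using assms by auto
  then show ?thesis
    using cscalar_prod_smult_unit_vec[of "A *\<^sub>v unit_vec n k" n k 1]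
      mult_smult_unit_vec[OF assms(1) assms(2) assms(2), of 1] assms
    by (simp add: expval_def)
qed

text \<open>Polarisation. The form is real at e_i + s e_j; s = 1 makes the imaginary parts of the
  (i, j) and (j, i) entries opposite, and s = \<i> makes their real parts equal.\<close>

lemma psd_hermitian:
  assumes "psd n A"
  shows "hermitian_op n A"
proof -
  have A: "A \<in> carrier_mat n n" and pos: "\<And>v. v \<in> carrier_vec n \<Longrightarrow> 0 \<le> expval v A"
    using assms by (auto simp: psd_def)
  have "A $$ (i, j) = cnj (A $$ (j, i))" if ij: "i < n" "j < n" for i j
  proof -
    have dg: "Im (A $$ (k, k)) = 0" if "k < n" for k
      using pos[of "unit_vec n k"] that by (simp add: expval_unit_vec[OF A] less_eq_complex_def)
    have e: "expval (unit_vec n i + s \<cdot>\<^sub>v unit_vec n j) A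
      = A $$ (i, i) + cnj s * s * A $$ (j, j) + cnj s * A $$ (j, i) + s * A $$ (i, j)" for s
    proof -
      have c: "A *\<^sub>v unit_vec n i \<in> carrier_vec n" "A *\<^sub>v (s \<cdot>\<^sub>v unit_vec n j) \<in> carrier_vec n"
        using A by auto
      have 1: "(A *\<^sub>v unit_vec n i) $ j = A $$ (j, i)"
        using mult_smult_unit_vec[OF A ij, of 1] by simp
      have 2: "(A *\<^sub>v (s \<cdot>\<^sub>v unit_vec n j)) \<bullet>c unit_vec n i = s * A $$ (i, j)"
        using cscalar_prod_smult_unit_vec[OF c(2) ij(1), of 1] mult_smult_unit_vec[OF A ij(2,1), of s]
        by simp
      show ?thesis using A ij
        by (simp add: expval_add[of _ n] expval_scaled[of _ n] expval_unit_vec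
            cscalar_prod_smult_unit_vec[OF c(1)] 1 2)
    qed
    have "Im (expval (unit_vec n i + s \<cdot>\<^sub>v unit_vec n j) A) = 0" for s
      using pos[of "unit_vec n i + s \<cdot>\<^sub>v unit_vec n j"] by (simp add: less_eq_complex_def)
    from this[of 1, unfolded e] this[of \<i>, unfolded e] dg[OF ij(1)] dg[OF ij(2)] show ?thesis
      by (simp add: complex_eq_iff)
  qed
  with A show ?thesis unfolding hermitian_op_iff by blast
qed

lemma cnj_mult_self_nonneg: "0 \<le> cnj z * (z::complex)"
  by (simp add: less_eq_complex_def mult.commute complex_mult_cnj)

text \<open>
  Cholesky elimination: subtracting \<open>|w\<rangle>\<langle>w|\<close> with \<open>w\<close> the \<open>k\<close>-th column divided by the square
  root of the pivot clears row \<open>k\<close>, and minimising the quadratic form along \<open>k\<close> shows that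
  the rest stays positive.
\<close>
lemma psd_ket_bra_decomp:
  assumes "psd n A"
  shows "\<exists>ws. set ws \<subseteq> carrier_vec n \<and>
    (\<forall>i<n. \<forall>j<n. A $$ (i, j) = (\<Sum>w\<leftarrow>ws. w $ i * cnj (w $ j)))"
proof -
  \<comment> \<open>The first \<open>k\<close> rows count as cleared. The induction runs downwards
    from \<open>k = n\<close>, where the whole matrix is 0, and \<open>A\<close> varies because each
    step continues with the remainder.\<close>
  have "\<exists>ws. set ws \<subseteq> carrier_vec n \<and> (\<forall>i<n. \<forall>j<n. A $$ (i, j) = (\<Sum>w\<leftarrow>ws. w $ i * cnj (w $ j)))"
    if "psd n A" "k \<le> n" "\<forall>i<k. \<forall>j<n. A $$ (i, j) = 0" for k A
    using that(2,1,3)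
  proof (induction k arbitrary: A rule: inc_induct)
    case base
    then show ?case by (intro exI[of _ "[]"]) auto
  next
    case (step k)
    have A: "A \<in> carrier_mat n n" and pos: "\<And>v. v \<in> carrier_vec n \<Longrightarrow> 0 \<le> expval v A"
      using step.prems by (auto simp: psd_def)
    have herm: "A $$ (i, j) = cnj (A $$ (j, i))" if "i < n" "j < n" for i j
      using psd_hermitian[OF step.prems(1), unfolded hermitian_op_iff] that by blast
    have k: "k < n" using step.hyps by simp
    let ?u = "unit_vec n k"
    define \<alpha> where "\<alpha> = Re (A $$ (k, k))"
    have \<alpha>: "A $$ (k, k) = of_real \<alpha>" "\<alpha> \<ge> 0"
    proof -
      have "0 \<le> A $$ (k, k)" using pos[of ?u] k by (simp add: expval_unit_vec[OF A])
      then show "A $$ (k, k) = of_real \<alpha>" "\<alpha> \<ge> 0"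
        by (simp_all add: \<alpha>_def less_eq_complex_def complex_eq_iff)
    qed
    have e: "expval (v + s \<cdot>\<^sub>v ?u) A
      = expval v A + cnj s * s * \<alpha> + cnj s * (A *\<^sub>v v) $ k + s * cnj ((A *\<^sub>v v) $ k)"
      if v: "v \<in> carrier_vec n" for v s
    proof -
      have c: "A *\<^sub>v v \<in> carrier_vec n" "A *\<^sub>v (s \<cdot>\<^sub>v ?u) \<in> carrier_vec n" using A v by auto
      have "(A *\<^sub>v (s \<cdot>\<^sub>v ?u)) \<bullet>c v = (\<Sum>i<n. s * A $$ (i, k) * cnj (v $ i))"
        using A k by (simp add: cscalar_prod_sum[OF c(2) v] mult_smult_unit_vec)
      also have "\<dots> = s * cnj (\<Sum>i<n. A $$ (k, i) * v $ i)"
        unfolding cnj_sum sum_distrib_left using herm[OF _ k] by (intro sum.cong) auto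
      finally have "(A *\<^sub>v (s \<cdot>\<^sub>v ?u)) \<bullet>c v = s * cnj ((A *\<^sub>v v) $ k)"
        by (simp only: index_mult_mat_vec_sum[OF A v k])
      then show ?thesis
        using A k v by (simp add: expval_add[of _ n] expval_scaled[of _ n] expval_unit_vec
            cscalar_prod_smult_unit_vec[OF c(1)] \<alpha>)
    qed
    show ?case
    proof (cases "\<alpha> = 0")
      case True
      \<comment> \<open>A zero pivot forces a zero row: if the entry z were nonzero, the form at e_j
        - t z e_k would be affine in t with slope -2 |z|^2, hence negative for large t. The value of
        t chosen below makes 2 t |z|^2 equal to \<beta> + 1.\<close>
      have "A $$ (k, j) = 0" if j: "j < n" for j
      proof (rule ccontr)
        assume nz: "A $$ (k, j) \<noteq> 0"
        let ?z = "A $$ (k, j)"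
        define \<beta> where "\<beta> = Re (A $$ (j, j))"
        have z: "(A *\<^sub>v unit_vec n j) $ k = ?z" using mult_smult_unit_vec[OF A j k, of 1] by simp
        have "0 \<le> Re (expval (unit_vec n j + (- of_real t * ?z) \<cdot>\<^sub>v ?u) A)" for t
          using pos[of "unit_vec n j + (- of_real t * ?z) \<cdot>\<^sub>v ?u"] by (simp add: less_eq_complex_def)
        also have "Re (expval (unit_vec n j + (- of_real t * ?z) \<cdot>\<^sub>v ?u) A) = \<beta> - 2 * t * (cmod ?z)\<^sup>2" for t
          by (simp add: e z True expval_unit_vec[OF A j] \<beta>_def cmod_def power2_eq_square ring_distribs)
        finally have le: "2 * t * (cmod ?z)\<^sup>2 \<le> \<beta>" for t by simp
        show False using le[of "(\<beta> + 1) / (2 * (cmod ?z)\<^sup>2)"] nz by simp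
      qed
      with step.prems have "\<forall>i<Suc k. \<forall>j<n. A $$ (i, j) = 0" by (auto simp: less_Suc_eq)
      with step.IH step.prems show ?thesis by blast
    next
      case False
      define w where "w = vec n (\<lambda>i. A $$ (i, k) / of_real (sqrt \<alpha>))"
      have w: "w \<in> carrier_vec n" by (simp add: w_def)
      have sq: "complex_of_real (sqrt \<alpha>) * of_real (sqrt \<alpha>) = of_real \<alpha>"
        using \<alpha>(2) by (simp flip: of_real_mult)
      have ww: "w $ i * cnj (w $ j) = A $$ (i, k) * A $$ (k, j) / \<alpha>" if "i < n" "j < n" for i j
        using that herm[OF k that(2)] by (simp add: w_def sq)
      define B where "B = mat n n (\<lambda>(i, j). A $$ (i, j) - w $ i * cnj (w $ j))"
      have B: "B \<in> carrier_mat n n" by (simp add: B_def)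
      have "expval v B \<ge> 0" if v: "v \<in> carrier_vec n" for v
      proof -
        let ?a = "(A *\<^sub>v v) $ k"
        have a1: "?a = (\<Sum>j<n. A $$ (k, j) * v $ j)" by (rule index_mult_mat_vec_sum[OF A v k])
        have a2: "cnj ?a = (\<Sum>i<n. cnj (v $ i) * A $$ (i, k))"
          unfolding a1 cnj_sum using herm[OF _ k] by (intro sum.cong) auto
        have "expval v B = expval v A
           - (\<Sum>i<n. \<Sum>j<n. (cnj (v $ i) * A $$ (i, k)) * (A $$ (k, j) * v $ j) / \<alpha>)"
          unfolding expval_sum[OF A v] expval_sum[OF B v] sum_subtractf[symmetric]
          by (intro sum.cong refl) (simp add: B_def ww algebra_simps)
        also have "(\<Sum>i<n. \<Sum>j<n. (cnj (v $ i) * A $$ (i, k)) * (A $$ (k, j) * v $ j) / \<alpha>)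
           = cnj ?a * ?a / \<alpha>"
          unfolding a1 a2[unfolded a1] sum_product sum_divide_distrib by (rule refl)
        also have "expval v A - cnj ?a * ?a / \<alpha> = expval (v + (- ?a / \<alpha>) \<cdot>\<^sub>v ?u) A"
          using False by (simp add: e[OF v] field_simps)
        also have "\<dots> \<ge> 0" using v by (intro pos) auto
        finally show ?thesis .
      qed
      with B have "psd n B" by (auto simp: psd_def)
      moreover have "B $$ (i, j) = 0" if "i < Suc k" "j < n" for i j
      proof (cases "i = k")
        case True
        with that k False show ?thesis by (simp add: B_def ww \<alpha>)
      next
        case False
        with that have "i < k" by simp
        with that k step.prems(2) show ?thesis by (simp add: B_def w_def)
      qed
      ultimately obtain ws where ws: "set ws \<subseteq> carrier_vec n"
        "\<forall>i<n. \<forall>j<n. B $$ (i, j) = (\<Sum>w\<leftarrow>ws. w $ i * cnj (w $ j))"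
        using step.IH[of B] by blast
      show ?thesis
      proof (intro exI[of _ "w # ws"] conjI allI impI)
        fix i j assume ij: "i < n" "j < n"
        then have "B $$ (i, j) = A $$ (i, j) - w $ i * cnj (w $ j)" by (simp add: B_def)
        with ws(2) ij show "A $$ (i, j) = (\<Sum>w\<leftarrow>w # ws. w $ i * cnj (w $ j))"
          by (simp add: eq_diff_eq add.commute)
      qed (use w ws in auto)
    qed
  qed
  from this[OF assms, of 0] show ?thesis by simp
qed

text \<open>If A is the sum of the |w><w|, then <v|A|v> is the sum of the |<w|v>|^2. It vanishes
  only if v is orthogonal to every w, and then every term of A v is 0.\<close>

lemma psd_expval_eq_0:
  assumes "psd n A" "v \<in> carrier_vec n" "expval v A = 0"
  shows "A *\<^sub>v v = 0\<^sub>v n"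
proof -
  have A: "A \<in> carrier_mat n n" using assms by (auto simp: psd_def)
  from psd_ket_bra_decomp[OF assms(1)] obtain ws where ws: "set ws \<subseteq> carrier_vec n"
    and Aij: "\<And>i j. i < n \<Longrightarrow> j < n \<Longrightarrow> A $$ (i, j) = (\<Sum>w\<leftarrow>ws. w $ i * cnj (w $ j))" by blast
  have Av: "(A *\<^sub>v v) $ i = (\<Sum>w\<leftarrow>ws. w $ i * (v \<bullet>c w))" if "i < n" for i
  proof -
    have "(A *\<^sub>v v) $ i = (\<Sum>j<n. \<Sum>w\<leftarrow>ws. w $ i * (cnj (w $ j) * v $ j))"
      unfolding index_mult_mat_vec_sum[OF A assms(2) that]
      using that by (intro sum.cong refl) (simp add: Aij sum_list_mult_const[symmetric] mult.assoc)
    also have "\<dots> = (\<Sum>w\<leftarrow>ws. \<Sum>j<n. w $ i * (cnj (w $ j) * v $ j))"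
      by (induction ws) (simp_all add: sum.distrib)
    also have "\<dots> = (\<Sum>w\<leftarrow>ws. w $ i * (v \<bullet>c w))"
      using ws assms(2)
      by (intro arg_cong[where f=sum_list] map_cong refl)
         (auto simp: cscalar_prod_sum[of _ n] sum_distrib_left mult_ac)
    finally show ?thesis .
  qed
  have "expval v A = (\<Sum>i<n. (\<Sum>w\<leftarrow>ws. w $ i * (v \<bullet>c w)) * cnj (v $ i))"
    unfolding expval_def using A assms(2) by (subst cscalar_prod_sum[of _ n]) (auto simp: Av simp del: index_mult_mat_vec)
  also have "\<dots> = (\<Sum>w\<leftarrow>ws. (v \<bullet>c w) * cnj (v \<bullet>c w))"
    using ws
  proof (induction ws)
    case (Cons w ws)
    then have w: "w \<in> carrier_vec n" by auto
    have "(\<Sum>i<n. w $ i * (v \<bullet>c w) * cnj (v $ i)) = (v \<bullet>c w) * (w \<bullet>c v)"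
      unfolding cscalar_prod_sum[OF w assms(2)] sum_distrib_left by (intro sum.cong) auto
    also have "w \<bullet>c v = cnj (v \<bullet>c w)" by (rule cscalar_prod_commute[OF assms(2) w])
    finally show ?case using Cons by (simp add: ring_distribs sum.distrib)
  qed simp
  finally have s0: "(\<Sum>w\<leftarrow>ws. (v \<bullet>c w) * cnj (v \<bullet>c w)) = 0" using assms(3) by simp
  have "\<forall>w\<in>set ws. v \<bullet>c w = 0"
    using s0 by (subst (asm) sum_list_nonneg_eq_0_iff) (auto simp: less_eq_complex_def)
  then show ?thesis using A assms(2)
    by (intro eq_vecI) (auto simp: Av simp del: index_mult_mat_vec intro!: sum_list_0 cong: map_cong)
qed

subsection \<open>Product vectors and compactness\<close>

text \<open>Bolzano-Weierstrass via monotone subsequences: one is chosen for the real parts, and a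
  further one inside it for the imaginary parts.\<close>

lemma bounded_complex_seq_convergent_subseq:
  fixes f :: "nat \<Rightarrow> complex"
  assumes "\<And>n. cmod (f n) \<le> B"
  shows "\<exists>r l. strict_mono r \<and> (\<lambda>n. f (r n)) \<longlonglongrightarrow> l"
proof -
  have sub: "\<exists>r l. strict_mono r \<and> (\<lambda>n. g (r n)) \<longlonglongrightarrow> l" if "\<And>n. \<bar>g n\<bar> \<le> B" for g :: "nat \<Rightarrow> real"
  proof -
    obtain r where r: "strict_mono r" "monoseq (\<lambda>n. g (r n))" using seq_monosub[of g] by blast
    have "Bseq (\<lambda>n. g (r n))" using that by (intro BseqI'[of _ B]) simp
    with r show ?thesis using Bseq_monoseq_convergent[of "\<lambda>n. g (r n)"]
      by (auto simp: convergent_def)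
  qed
  have "\<bar>Re (f n)\<bar> \<le> B" for n using abs_Re_le_cmod[of "f n"] assms[of n] by linarith
  from sub[of "\<lambda>n. Re (f n)", OF this] obtain r a where r: "strict_mono r" "(\<lambda>n. Re (f (r n))) \<longlonglongrightarrow> a" by blast
  have "\<bar>Im (f (r n))\<bar> \<le> B" for n using abs_Im_le_cmod[of "f (r n)"] assms[of "r n"] by linarith
  from sub[of "\<lambda>n. Im (f (r n))", OF this] obtain s b where s: "strict_mono s" "(\<lambda>n. Im (f (r (s n)))) \<longlonglongrightarrow> b" by blast
  have "(\<lambda>n. Re (f (r (s n)))) \<longlonglongrightarrow> a"
    using LIMSEQ_subseq_LIMSEQ[OF r(2) s(1)] by (simp add: o_def)
  with s have "(\<lambda>n. f (r (s n))) \<longlonglongrightarrow> Complex a b" by (simp add: tendsto_complex_iff)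
  with r s show ?thesis using strict_mono_o[OF r(1) s(1)] by (auto simp: o_def)
qed

lemma bounded_complex_family_convergent_subseq:
  fixes f :: "nat \<Rightarrow> nat \<Rightarrow> complex"
  assumes "\<And>n i. i < k \<Longrightarrow> cmod (f n i) \<le> B"
  shows "\<exists>r l. strict_mono r \<and> (\<forall>i<k. (\<lambda>n. f (r n) i) \<longlonglongrightarrow> l i)"
  using assms
proof (induction k)
  case 0
  then show ?case using strict_mono_id by auto
next
  case (Suc k)
  then obtain r l where r: "strict_mono r" "\<forall>i<k. (\<lambda>n. f (r n) i) \<longlonglongrightarrow> l i"
    by (metis less_SucI)
  obtain s a where s: "strict_mono s" "(\<lambda>n. f (r (s n)) k) \<longlonglongrightarrow> a"
    using bounded_complex_seq_convergent_subseq[of "\<lambda>n. f (r n) k" B] Suc.prems[of k] by auto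
  have "(\<lambda>n. f (r (s n)) i) \<longlonglongrightarrow> (l(k := a)) i" if "i < Suc k" for i
  proof (cases "i = k")
    case False
    with that r(2) have "(\<lambda>n. f (r n) i) \<longlonglongrightarrow> l i" by simp
    from LIMSEQ_subseq_LIMSEQ[OF this s(1)] show ?thesis using False by (simp add: o_def)
  qed (use s in simp)
  then show ?case using strict_mono_o[OF r(1) s(1)]
    by (intro exI[of _ "r \<circ> s"] exI[of _ "l(k := a)"]) (simp add: o_def)
qed

definition unit_vector :: "nat \<Rightarrow> complex vec \<Rightarrow> bool" where
  "unit_vector n v \<longleftrightarrow> v \<in> carrier_vec n \<and> v \<bullet>c v = 1"

lemma unit_vectorD: "unit_vector n v \<Longrightarrow> v \<in> carrier_vec n"
  by (simp add: unit_vector_def)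

lemma cscalar_prod_self:
  fixes v :: "complex vec"
  assumes "v \<in> carrier_vec n"
  shows "v \<bullet>c v = of_real (\<Sum>i<n. (cmod (v $ i))\<^sup>2)"
  by (simp add: cscalar_prod_sum[OF assms assms] complex_norm_square flip: of_real_power)

text \<open>Entries of unit vectors are bounded by 1, and the norm is a finite sum of products of
  entries, so it passes to the limit.\<close>

lemma unit_vector_subseq:
  fixes V :: "nat \<Rightarrow> complex vec"
  assumes "\<And>n. unit_vector d (V n)"
  shows "\<exists>r v. strict_mono r \<and> unit_vector d v \<and> (\<forall>i<d. (\<lambda>n. V (r n) $ i) \<longlonglongrightarrow> v $ i)"
proof -
  have c: "V n \<in> carrier_vec d" and one: "V n \<bullet>c V n = 1" for n
    using assms by (auto simp: unit_vector_def)
  have "cmod (V n $ i) \<le> 1" if "i < d" for n i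
  proof -
    have "(cmod (V n $ i))\<^sup>2 \<le> (\<Sum>i<d. (cmod (V n $ i))\<^sup>2)"
      using that by (intro member_le_sum) auto
    also have "\<dots> = 1" using one[of n] unfolding cscalar_prod_self[OF c] by (simp only: of_real_eq_1_iff)
    finally show ?thesis by (simp add: power_le_one_iff)
  qed
  from bounded_complex_family_convergent_subseq[of d "\<lambda>n i. V n $ i", OF this]
  obtain r l where r: "strict_mono r" and l: "\<forall>i<d. (\<lambda>n. V (r n) $ i) \<longlonglongrightarrow> l i"
    by blast
  have "(\<lambda>n. \<Sum>i<d. V (r n) $ i * cnj (V (r n) $ i)) \<longlonglongrightarrow> (\<Sum>i<d. l i * cnj (l i))"
    using l by (intro tendsto_sum tendsto_mult tendsto_cnj) auto
  moreover have "(\<Sum>i<d. V (r n) $ i * cnj (V (r n) $ i)) = 1" for n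
    using one[of "r n"] unfolding cscalar_prod_sum[OF c c] .
  ultimately have "(\<Sum>i<d. l i * cnj (l i)) = 1" by (simp add: LIMSEQ_const_iff)
  then have "unit_vector d (vec d l)"
    by (simp add: unit_vector_def cscalar_prod_sum[of _ d])
  then show ?thesis using r l by (intro exI[of _ r] exI[of _ "vec d l"]) auto
qed

lemma mult_add_less_mult:
  fixes a b d m :: nat
  assumes "a < d" "b < m"
  shows "a * m + b < d * m"
proof -
  have "a * m + b < Suc a * m" using assms by simp
  also have "\<dots> \<le> d * m" using assms by (intro mult_right_mono) auto
  finally show ?thesis .
qed

lemma less_mult_split:
  fixes i d m :: nat
  assumes "i < d * m"
  obtains a b where "a < d" "b < m" "i = a * m + b"
proof
  have "m > 0" using assms by (cases m) auto
  then show "i div m < d" "i mod m < m" "i = i div m * m + i mod m"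
    using assms by (auto simp: less_mult_imp_div_less)
qed

lemma sum_lessThan_mult:
  fixes f :: "nat \<Rightarrow> 'a::comm_monoid_add"
  shows "(\<Sum>i<d * m. f i) = (\<Sum>a<d. \<Sum>b<m. f (a * m + b))"
proof -
  have "sum f {a * m..<a * m + m} = (\<Sum>b<m. f (a * m + b))" for a
    using sum.shift_bounds_nat_ivl[of f 0 "a * m" m]
    by (simp add: lessThan_atLeast0 add.commute)
  then show ?thesis using sum.nat_group[of f m d] by simp
qed

lemma index_kron_vec:
  assumes "v \<in> carrier_vec d" "w \<in> carrier_vec m" "a < d" "b < m"
  shows "kron_vec v w $ (a * m + b) = v $ a * w $ b"
  using assms mult_add_less_mult[OF assms(3,4)] by (auto simp: kron_vec_def)

lemma kron_vec_carrier:
  "v \<in> carrier_vec d \<Longrightarrow> w \<in> carrier_vec m \<Longrightarrow> kron_vec v w \<in> carrier_vec (d * m)"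
  by (auto simp: kron_vec_def)

lemma tensor_vec_Cons: "tensor_vec (v # vs) = kron_vec v (tensor_vec vs)"
  by (simp add: tensor_vec_def)

lemma tensor_vec_carrier:
  assumes "list_all2 (\<lambda>d v. v \<in> carrier_vec d) ds vs"
  shows "tensor_vec vs \<in> carrier_vec (prod_list ds)"
  using assms
  by induction (auto simp: tensor_vec_Cons intro: kron_vec_carrier, simp add: tensor_vec_def)

lemma unit_vectors_tensor_carrier:
  "list_all2 unit_vector ds vs \<Longrightarrow> tensor_vec vs \<in> carrier_vec (prod_list ds)"
  by (rule tensor_vec_carrier) (auto elim: list_all2_mono simp: unit_vector_def)

text \<open>Subsequences are taken for the factors and not for the tensor products. The limit is
  then a product of unit vectors by construction, and closedness of the set of product vectors needs
  no separate argument.\<close>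

lemma unit_product_subseq:
  fixes V :: "nat \<Rightarrow> complex vec list"
  assumes "\<And>n. list_all2 unit_vector ds (V n)"
  shows "\<exists>r vs. strict_mono r \<and> list_all2 unit_vector ds vs \<and>
    (\<forall>i<prod_list ds. (\<lambda>n. tensor_vec (V (r n)) $ i) \<longlonglongrightarrow> tensor_vec vs $ i)"
  using assms
proof (induction ds arbitrary: V)
  case Nil
  then have "V n = []" for n by auto
  then show ?case
    by (intro exI[of _ "\<lambda>n. n"] exI[of _ "[]"]) (simp add: strict_mono_def)
next
  case (Cons d ds)
  define v where "v n = hd (V n)" for n
  define T where "T n = tl (V n)" for n
  have V: "V n = v n # T n" "unit_vector d (v n)" "list_all2 unit_vector ds (T n)" for n
    using Cons.prems[of n] unfolding v_def T_def by (cases "V n"; auto)+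
  from Cons.IH[of T] V obtain r us where r: "strict_mono r" "list_all2 unit_vector ds us"
    "\<forall>i<prod_list ds. (\<lambda>n. tensor_vec (T (r n)) $ i) \<longlonglongrightarrow> tensor_vec us $ i" by blast
  from unit_vector_subseq[of d "\<lambda>n. v (r n)"] V obtain s u where s: "strict_mono s" "unit_vector d u"
    "\<forall>i<d. (\<lambda>n. v (r (s n)) $ i) \<longlonglongrightarrow> u $ i" by blast
  have "(\<lambda>n. tensor_vec (V (r (s n))) $ i) \<longlonglongrightarrow> tensor_vec (u # us) $ i" if "i < prod_list (d # ds)" for i
  proof -
    from that obtain a b where ab: "a < d" "b < prod_list ds" "i = a * prod_list ds + b"
      by (auto elim: less_mult_split)
    have "(\<lambda>n. tensor_vec (T (r (s n))) $ b) \<longlonglongrightarrow> tensor_vec us $ b"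
      using LIMSEQ_subseq_LIMSEQ[OF r(3)[rule_format, OF ab(2)] s(1)] by (simp add: o_def)
    then have "(\<lambda>n. v (r (s n)) $ a * tensor_vec (T (r (s n))) $ b) \<longlonglongrightarrow> u $ a * tensor_vec us $ b"
      using s(3) ab by (intro tendsto_mult) auto
    moreover have "tensor_vec (w # ws) $ i = w $ a * tensor_vec ws $ b"
      if "unit_vector d w" "list_all2 unit_vector ds ws" for w ws
      unfolding tensor_vec_Cons ab(3)
      by (rule index_kron_vec[OF unit_vectorD[OF that(1)] unit_vectors_tensor_carrier[OF that(2)] ab(1,2)])
    ultimately show ?thesis using V r(2) s(2) by simp
  qed
  then show ?case using r s strict_mono_o[OF r(1) s(1)]
    by (intro exI[of _ "r \<circ> s"] exI[of _ "u # us"]) (auto simp: o_def)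
qed

text \<open>The direct method. Compactness also gives boundedness from below: values below -n along
  a sequence would contradict convergence of the values along a subsequence. The premise
  \<open>ex\<close> makes the set of values nonempty, so that its infimum is meaningful.\<close>

lemma Re_expval_product_attains_min:
  assumes A: "A \<in> carrier_mat (prod_list ds) (prod_list ds)" and ex: "list_all2 unit_vector ds ws"
  shows "\<exists>vs. list_all2 unit_vector ds vs \<and>
    (\<forall>us. list_all2 unit_vector ds us \<longrightarrow> Re (expval (tensor_vec vs) A) \<le> Re (expval (tensor_vec us) A))"
proof -
  define f where "f vs = Re (expval (tensor_vec vs) A)" for vs
  define F where "F = {vs. list_all2 unit_vector ds vs}"
  have sub: "\<exists>r vs. strict_mono r \<and> vs \<in> F \<and> (\<lambda>n. f (V (r n))) \<longlonglongrightarrow> f vs"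
    if V: "\<And>n. V n \<in> F" for V :: "nat \<Rightarrow> complex vec list"
  proof -
    let ?N = "prod_list ds"
    have VF: "list_all2 unit_vector ds (V n)" for n using V by (simp add: F_def)
    from unit_product_subseq[of ds V, OF VF] obtain r vs where r: "strict_mono r" "list_all2 unit_vector ds vs"
      "\<forall>i<?N. (\<lambda>n. tensor_vec (V (r n)) $ i) \<longlonglongrightarrow> tensor_vec vs $ i" by blast
    have e: "f us = Re (\<Sum>i<?N. \<Sum>j<?N. cnj (tensor_vec us $ i) * A $$ (i, j) * tensor_vec us $ j)"
      if "list_all2 unit_vector ds us" for us
      unfolding f_def by (subst expval_sum[OF A unit_vectors_tensor_carrier[OF that]]) (rule refl)
    have "(\<lambda>n. f (V (r n))) \<longlonglongrightarrow> f vs"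
      unfolding e[OF r(2)] e[OF VF] using r(3)
      by (intro tendsto_Re tendsto_sum tendsto_mult tendsto_cnj tendsto_const) auto
    with r show ?thesis by (auto simp: F_def)
  qed
  have ne: "f ` F \<noteq> {}" using ex by (auto simp: F_def)
  have bdd: "bdd_below (f ` F)"
  proof (rule ccontr)
    assume "\<not> bdd_below (f ` F)"
    then have "\<exists>vs\<in>F. f vs < - real n" for n
      unfolding bdd_below_def by (metis imageE linorder_not_le)
    then obtain V where V: "\<And>n. V n \<in> F" "\<And>n. f (V n) < - real n" by metis
    from sub[of V, OF V(1)] obtain r vs where r: "strict_mono r" "(\<lambda>n. f (V (r n))) \<longlonglongrightarrow> f vs" by blast
    then obtain K where K: "\<And>n. norm (f (V (r n))) \<le> K"
      using Bseq_def convergent_imp_Bseq convergentI by metis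
    obtain n where n: "K < real n" using reals_Archimedean2 by blast
    have "real n \<le> real (r n)" using r(1) by (simp add: strict_mono_imp_increasing)
    with K[of n] V(2)[of "r n"] n show False by (simp add: abs_le_iff)
  qed
  define m where "m = Inf (f ` F)"
  have le: "m \<le> f vs" if "vs \<in> F" for vs unfolding m_def using that bdd by (intro cInf_lower) auto
  have "\<exists>vs\<in>F. f vs < m + inverse (real (Suc n))" for n
  proof -
    have "m < m + inverse (real (Suc n))" by simp
    from this[unfolded m_def cInf_less_iff[OF ne bdd]] show ?thesis by (auto simp: m_def)
  qed
  then obtain V where V: "\<And>n. V n \<in> F" "\<And>n. f (V n) < m + inverse (real (Suc n))" by metis
  from sub[of V, OF V(1)] obtain r vs where r: "strict_mono r" "vs \<in> F" "(\<lambda>n. f (V (r n))) \<longlonglongrightarrow> f vs" by blast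
  have "(\<lambda>n. m + inverse (real (Suc n))) \<longlonglongrightarrow> m + 0"
    by (intro tendsto_add tendsto_const LIMSEQ_inverse_real_of_nat)
  from LIMSEQ_subseq_LIMSEQ[OF this r(1)]
  have "(\<lambda>n. m + inverse (real (Suc (r n)))) \<longlonglongrightarrow> m" by (simp add: o_def)
  with r(3) have "f vs \<le> m"
    by (rule LIMSEQ_le) (use V(2) in \<open>auto intro: less_imp_le\<close>)
  with r(2) le show ?thesis
    unfolding f_def F_def by (intro exI[of _ vs]) (auto intro: order_trans)
qed

section \<open>Positivity by eigenvalues and positivity by the quadratic form\<close>

lemma expval_minus_smult:
  assumes "A \<in> carrier_mat n n" "B \<in> carrier_mat n n" "v \<in> carrier_vec n"
  shows "expval v (A - a \<cdot>\<^sub>m B) = expval v A - a * expval v B"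
proof -
  have "A - a \<cdot>\<^sub>m B \<in> carrier_mat n n" using assms by auto
  moreover have "(A - a \<cdot>\<^sub>m B) $$ (i, j) = A $$ (i, j) - a * B $$ (i, j)" if "i < n" "j < n" for i j
    using assms that by auto
  ultimately show ?thesis using assms
    by (simp add: expval_sum[of _ n] sum_distrib_left flip: sum_subtractf)
       (auto simp: algebra_simps intro!: sum.cong)
qed

lemma expval_one: "v \<in> carrier_vec n \<Longrightarrow> expval v (1\<^sub>m n) = v \<bullet>c v"
  by (simp add: expval_def)

lemma hermitian_expval_real:
  assumes "hermitian_op n A" "v \<in> carrier_vec n"
  shows "Im (expval v A) = 0"
proof -
  have A: "A \<in> carrier_mat n n" using assms by (auto simp: hermitian_op_iff)
  have H: "cnj (A $$ (j, i)) = A $$ (i, j)" if "i < n" "j < n" for i j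
    using assms(1) that unfolding hermitian_op_iff by metis
  have "cnj (expval v A) = (\<Sum>i<n. \<Sum>j<n. v $ i * A $$ (j, i) * cnj (v $ j))"
    using A assms(2) H by (simp add: expval_sum[of _ n])
  also have "\<dots> = expval v A"
    unfolding expval_sum[OF A assms(2)] by (subst sum.swap) (simp add: mult_ac)
  finally show ?thesis by (simp add: complex_eq_iff)
qed

lemma nonzero_vec_eq_smult_unit:
  assumes "v \<in> carrier_vec n" "v \<noteq> 0\<^sub>v n"
  shows "\<exists>t u. 0 < t \<and> unit_vector n u \<and> v = complex_of_real t \<cdot>\<^sub>v u"
proof -
  define q where "q = (\<Sum>i<n. (cmod (v $ i))\<^sup>2)"
  have q: "v \<bullet>c v = of_real q" "q \<ge> 0"
    using cscalar_prod_self[OF assms(1)] by (auto simp: q_def intro: sum_nonneg)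
  moreover have "v \<bullet>c v \<noteq> 0" using assms by simp
  ultimately have q0: "q > 0" by (cases "q = 0") auto
  define u where "u = (1 / complex_of_real (sqrt q)) \<cdot>\<^sub>v v"
  have u: "u \<in> carrier_vec n" using assms by (simp add: u_def)
  have sq: "complex_of_real (sqrt q) * of_real (sqrt q) = of_real q"
    using q0 by (simp flip: of_real_mult)
  have "u \<bullet>c u = (\<Sum>i<n. v $ i * cnj (v $ i) / of_real q)"
    unfolding cscalar_prod_sum[OF u u] using assms(1)
    by (intro sum.cong) (auto simp: u_def sq[symmetric])
  also have "\<dots> = 1" using q(1)[unfolded cscalar_prod_sum[OF assms(1) assms(1)]] q0
    by (simp flip: sum_divide_distrib)
  finally have "unit_vector n u" using u by (simp add: unit_vector_def)
  moreover have "v = complex_of_real (sqrt q) \<cdot>\<^sub>v u" using q0 assms(1)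
    by (auto simp: u_def smult_smult_assoc)
  ultimately show ?thesis using q0 by (intro exI[of _ "sqrt q"]) auto
qed

lemma expval_zero_vec: "A \<in> carrier_mat n n \<Longrightarrow> expval (0\<^sub>v n) A = 0"
  by (simp add: expval_sum[of _ n])

lemma psd_unitI:
  assumes A: "A \<in> carrier_mat n n" and pos: "\<And>u. unit_vector n u \<Longrightarrow> 0 \<le> expval u A"
  shows "psd n A"
  unfolding psd_def
proof (intro conjI ballI A)
  fix v :: "complex vec" assume v: "v \<in> carrier_vec n"
  show "0 \<le> expval v A"
  proof (cases "v = 0\<^sub>v n")
    case True then show ?thesis using A by (simp add: expval_zero_vec)
  next
    case False
    with nonzero_vec_eq_smult_unit[OF v] obtain t u where
      u: "0 < t" "unit_vector n u" "v = complex_of_real t \<cdot>\<^sub>v u" by blast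
    have "expval v A = of_real (t * t) * expval u A"
      using u(2) by (simp add: u(3) expval_scaled[OF A unit_vectorD])
    then show ?thesis using pos[OF u(2)] by (auto simp: less_eq_complex_def)
  qed
qed

lemma tensor_vec_single: "tensor_vec [v] = v"
  by (auto simp: tensor_vec_def kron_vec_def)

lemma unit_vector_unit_vec: "k < n \<Longrightarrow> unit_vector n (unit_vec n k)"
  using cscalar_prod_smult_unit_vec[of "unit_vec n k" n k 1] by (simp add: unit_vector_def)

text \<open>
  The minimum of the quadratic form on the unit sphere is an eigenvalue, because there the
  shifted form is positive and vanishes.
\<close>
lemma positive_op_iff_psd: "positive_op n A \<longleftrightarrow> psd n A"
proof
  assume psd: "psd n A"
  then have A: "A \<in> carrier_mat n n" by (simp add: psd_def)
  have "0 \<le> k" if ev: "eigenvalue A k" for k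
  proof -
    from ev A obtain v where v: "v \<in> carrier_vec n" "v \<noteq> 0\<^sub>v n" "A *\<^sub>v v = k \<cdot>\<^sub>v v"
      by (auto simp: eigenvalue_def eigenvector_def)
    from nonzero_vec_eq_smult_unit[OF v(1,2)] obtain t u where
      u: "0 < t" "unit_vector n u" "v = complex_of_real t \<cdot>\<^sub>v u" by blast
    have "0 \<le> expval v A" using psd v by (simp add: psd_def)
    also have "expval v A = k * (v \<bullet>c v)" using v by (simp add: expval_def)
    also have "v \<bullet>c v = of_real (t * t)"
      using u(2) expval_scaled[of "1\<^sub>m n" n u "of_real t"] v(1) unfolding u(3)
      by (simp add: expval_one unit_vector_def)
    finally have *: "0 \<le> k * of_real (t * t)" .
    have "0 < t * t" using u(1) by simp
    with * show ?thesis by (auto simp: less_eq_complex_def zero_le_mult_iff)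
  qed
  then show "positive_op n A" using psd_hermitian[OF psd] by (auto simp: positive_op_def)
next
  assume pos: "positive_op n A"
  then have A: "A \<in> carrier_mat n n" and herm: "hermitian_op n A"
    by (auto simp: positive_op_def hermitian_op_def)
  show "psd n A"
  \<comment> \<open>In dimension 0 there is no unit vector to minimise over.\<close>
  proof (cases "n = 0")
    case True
    then show ?thesis using A by (simp add: psd_def expval_sum[of _ 0])
  next
    case False
    \<comment> \<open>The unit sphere is treated as the set of product vectors with the single
      factor \<open>n\<close>.\<close>
    have 1: "list_all2 unit_vector [n] [v] \<longleftrightarrow> unit_vector n v" for v by simp
    have "list_all2 unit_vector [n] [unit_vec n 0]" using False by (simp add: unit_vector_unit_vec)
    from Re_expval_product_attains_min[OF _ this, of A] A obtain vs where
      "list_all2 unit_vector [n] vs"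
      and min: "\<And>us. list_all2 unit_vector [n] us \<Longrightarrow> Re (expval (tensor_vec vs) A) \<le> Re (expval (tensor_vec us) A)"
      by auto
    then obtain v where v: "vs = [v]" "unit_vector n v" by (auto simp: list_all2_Cons1)
    define \<mu> where "\<mu> = Re (expval v A)"
    have exp_v: "expval v A = of_real \<mu>"
      using hermitian_expval_real[OF herm unit_vectorD[OF v(2)]] by (simp add: \<mu>_def complex_eq_iff)
    define B where "B = A - complex_of_real \<mu> \<cdot>\<^sub>m 1\<^sub>m n"
    have B: "B \<in> carrier_mat n n" using A by (auto simp: B_def)
    have expB: "expval w B = expval w A - of_real \<mu> * (w \<bullet>c w)" if "w \<in> carrier_vec n" for w
      unfolding B_def using that A by (simp add: expval_minus_smult[of _ n] expval_one)
    have "psd n B"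
    proof (rule psd_unitI[OF B])
      fix u assume u: "unit_vector n u"
      have "\<mu> \<le> Re (expval u A)" using min[of "[u]"] u by (simp add: v \<mu>_def tensor_vec_single)
      with u hermitian_expval_real[OF herm unit_vectorD[OF u]] show "0 \<le> expval u B"
        by (simp add: expB unit_vector_def less_eq_complex_def)
    qed
    moreover have "expval v B = 0" using v exp_v by (simp add: expB unit_vector_def)
    ultimately have Bv: "B *\<^sub>v v = 0\<^sub>v n"
      using v(2) by (intro psd_expval_eq_0) (auto simp: unit_vector_def)
    have vc: "v \<in> carrier_vec n" using v(2) by (rule unit_vectorD)
    have "A *\<^sub>v v = of_real \<mu> \<cdot>\<^sub>v v"
    proof (rule eq_vecI)
      fix i assume "i < dim_vec (complex_of_real \<mu> \<cdot>\<^sub>v v)"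
      then have i: "i < n" using vc by simp
      have "(B *\<^sub>v v) $ i = (\<Sum>j<n. A $$ (i, j) * v $ j - (if j = i then of_real \<mu> * v $ i else 0))"
        unfolding index_mult_mat_vec_sum[OF B vc i]
        using A i by (intro sum.cong) (auto simp: B_def algebra_simps)
      also have "\<dots> = (A *\<^sub>v v) $ i - of_real \<mu> * v $ i"
        unfolding index_mult_mat_vec_sum[OF A vc i] using i by (simp add: sum_subtractf)
      finally show "(A *\<^sub>v v) $ i = (of_real \<mu> \<cdot>\<^sub>v v) $ i"
        using Bv i vc by simp
    qed (use A vc in auto)
    moreover have "v \<noteq> 0\<^sub>v n" using v(2) by (auto simp: unit_vector_def)
    ultimately have "eigenvalue A (of_real \<mu>)"
      using A unit_vectorD[OF v(2)] by (auto simp: eigenvalue_def eigenvector_def)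
    with pos have \<mu>: "0 \<le> \<mu>" by (auto simp: positive_op_def less_eq_complex_def)
    show ?thesis
    proof (rule psd_unitI[OF A])
      fix u assume u: "unit_vector n u"
      have "0 \<le> expval u B" using \<open>psd n B\<close> u by (simp add: psd_def unit_vector_def)
      with u \<mu> show "0 \<le> expval u A"
        by (simp add: expB unit_vector_def less_eq_complex_def)
    qed
  qed
qed

subsection \<open>Tensor products of positive operators\<close>

lemma (in vec_space) col_nonzero_imp_rank_pos:
  assumes A: "A \<in> carrier_mat n nc" and j: "j < nc" "col A j \<noteq> 0\<^sub>v n"
  shows "1 \<le> rank A"
proof -
  let ?u = "col A j"
  have u: "?u \<in> carrier_vec n" using A by auto
  have "lin_indpt {?u}"
  proof
    assume dep: "lin_dep {?u}"
    let ?M = "mat_of_cols n [?u]"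
    have cols: "cols ?M = [?u]" using u by (intro cols_mat_of_cols) auto
    have M: "?M \<in> carrier_mat n 1" by (simp add: mat_of_cols_def)
    from lin_depE[OF M] dep cols obtain v where v: "v \<in> carrier_vec 1" "v \<noteq> 0\<^sub>v 1" "?M *\<^sub>v v = 0\<^sub>v n"
      by auto
    have v0: "v $ 0 \<noteq> 0" using v by (auto simp: vec_eq_iff)
    have "?u $ i = 0" if "i < n" for i
    proof -
      have "(?M *\<^sub>v v) $ i = 0" using v(3) that by simp
      moreover have "(?M *\<^sub>v v) $ i = ?u $ i * v $ 0"
        using that v(1) u A j by (simp add: scalar_prod_def mat_of_cols_def)
      ultimately show ?thesis using v0 by simp
    qed
    then have "?u = 0\<^sub>v n" using u by (intro eq_vecI) (simp_all del: index_col dim_col)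
    with j show False by simp
  qed
  moreover have "{?u} \<subseteq> set (cols A)" using A j by (auto simp: cols_def)
  ultimately show ?thesis using rank_ge_card_indpt[OF A, of "{?u}"] by simp
qed

lemma (in vec_space) rank_le_1_imp_cols_proportional:
  assumes A: "A \<in> carrier_mat n nc" and r: "rank A \<le> 1"
    and j: "j < nc" "col A j \<noteq> 0\<^sub>v n" and i: "i < nc"
  shows "\<exists>a. col A i = a \<cdot>\<^sub>v col A j"
proof (cases "col A i = col A j")
  case True
  then show ?thesis by (intro exI[of _ 1]) simp
next
  case False
  let ?u = "col A j" and ?w = "col A i"
  have u: "?u \<in> carrier_vec n" "?w \<in> carrier_vec n" using A by auto
  have "{?u, ?w} \<subseteq> set (cols A)" using A i j by (auto simp: cols_def)
  then have dep: "lin_dep {?u, ?w}"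
    using rank_ge_card_indpt[OF A, of "{?u, ?w}"] r False by auto
  let ?M = "mat_of_cols n [?u, ?w]"
  have cols: "cols ?M = [?u, ?w]" using u by (intro cols_mat_of_cols) auto
  have M: "?M \<in> carrier_mat n 2" by (simp add: mat_of_cols_def numeral_2_eq_2)
  from lin_depE[OF M] dep cols False obtain v where
    v: "v \<in> carrier_vec 2" "v \<noteq> 0\<^sub>v 2" "?M *\<^sub>v v = 0\<^sub>v n"
    by (auto simp: insert_commute)
  have e: "?u $ k * v $ 0 + ?w $ k * v $ 1 = 0" if "k < n" for k
  proof -
    have "(?M *\<^sub>v v) $ k = 0" using v(3) that by simp
    moreover have "(?M *\<^sub>v v) $ k = ?u $ k * v $ 0 + ?w $ k * v $ 1"
      using that v(1) u A j by (simp add: scalar_prod_def mat_of_cols_def numeral_2_eq_2)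
    ultimately show ?thesis by simp
  qed
  have v1: "v $ 1 \<noteq> 0"
  proof
    assume v1: "v $ 1 = 0"
    with v(1,2) have "v $ 0 \<noteq> 0" by (auto simp: vec_eq_iff less_2_cases_iff)
    with e v1 have "?u $ k = 0" if "k < n" for k using that by fastforce
    then have "?u = 0\<^sub>v n" using u by (intro eq_vecI) (simp_all del: index_col dim_col)
    with j show False by simp
  qed
  have "?w $ k = (- v $ 0 / v $ 1) * ?u $ k" if "k < n" for k
    using e[OF that] v1 by (simp add: field_simps eq_neg_iff_add_eq_0)
  then have "?w = (- v $ 0 / v $ 1) \<cdot>\<^sub>v ?u" using u A by (intro eq_vecI) auto
  then show ?thesis by blast
qed

lemma hermitian_cscalar_prod:
  assumes "hermitian_op n A" "v \<in> carrier_vec n" "w \<in> carrier_vec n"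
  shows "(A *\<^sub>v v) \<bullet>c w = v \<bullet>c (A *\<^sub>v w)"
proof -
  have A: "A \<in> carrier_mat n n" using assms by (auto simp: hermitian_op_iff)
  have H: "cnj (A $$ (j, i)) = A $$ (i, j)" if "i < n" "j < n" for i j
    using assms(1) that unfolding hermitian_op_iff by metis
  have "(A *\<^sub>v v) \<bullet>c w = (\<Sum>i<n. \<Sum>j<n. A $$ (i, j) * v $ j * cnj (w $ i))"
    using A assms(2,3) by (subst cscalar_prod_sum[of _ n])
      (auto simp: index_mult_mat_vec_sum[OF A assms(2)] sum_distrib_right simp del: index_mult_mat_vec)
  also have "\<dots> = (\<Sum>j<n. \<Sum>i<n. A $$ (i, j) * v $ j * cnj (w $ i))" by (rule sum.swap)
  also have "\<dots> = (\<Sum>j<n. v $ j * cnj ((A *\<^sub>v w) $ j))"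
  proof (intro sum.cong refl)
    fix j assume "j \<in> {..<n}"
    then have j: "j < n" by simp
    show "(\<Sum>i<n. A $$ (i, j) * v $ j * cnj (w $ i)) = v $ j * cnj ((A *\<^sub>v w) $ j)"
      unfolding index_mult_mat_vec_sum[OF A assms(3) j] cnj_sum sum_distrib_left
      using H j by (intro sum.cong) auto
  qed
  also have "\<dots> = v \<bullet>c (A *\<^sub>v w)"
    using A assms(2,3) by (subst cscalar_prod_sum[of _ n]) auto
  finally show ?thesis .
qed

lemma orth_projector_carrier: "orth_projector n P \<Longrightarrow> P \<in> carrier_mat n n"
  by (auto simp: orth_projector_def hermitian_op_def)

lemma expval_orth_projector:
  assumes "orth_projector n P" "v \<in> carrier_vec n"
  shows "expval v P = (P *\<^sub>v v) \<bullet>c (P *\<^sub>v v)"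
proof -
  have P: "P \<in> carrier_mat n n" "hermitian_op n P" "P * P = P"
    using assms by (auto simp: orth_projector_def hermitian_op_def)
  then have "P *\<^sub>v v = P *\<^sub>v (P *\<^sub>v v)" using assms(2) by (metis assoc_mult_mat_vec)
  then show ?thesis unfolding expval_def
    using hermitian_cscalar_prod[OF P(2), of "P *\<^sub>v v" v] P assms(2) by auto
qed

lemma cscalar_prod_self_nonneg:
  fixes v :: "complex vec"
  shows "0 \<le> v \<bullet>c v"
  unfolding cscalar_prod_self[OF carrier_vec_dim_vec] by (simp add: less_eq_complex_def sum_nonneg)

lemma orth_projector_psd: "orth_projector n P \<Longrightarrow> psd n P"
  unfolding psd_def by (simp add: orth_projector_carrier expval_orth_projector cscalar_prod_self_nonneg)

lemma orth_projector_ket_bra: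
  assumes "unit_vector n v"
  shows "orth_projector n (ket_bra v)"
proof -
  have v: "v \<in> carrier_vec n" using assms by (rule unit_vectorD)
  have one: "(\<Sum>k<n. v $ k * cnj (v $ k)) = 1"
    using assms cscalar_prod_sum[OF v v] by (simp add: unit_vector_def)
  have "(ket_bra v * ket_bra v) $$ (i, j) = ket_bra v $$ (i, j)" if "i < n" "j < n" for i j
  proof -
    have "(ket_bra v * ket_bra v) $$ (i, j) = (\<Sum>k<n. v $ i * (v $ k * cnj (v $ k)) * cnj (v $ j))"
      using that v by (auto simp: ket_bra_def scalar_prod_def lessThan_atLeast0 mult_ac intro!: sum.cong)
    also have "\<dots> = v $ i * cnj (v $ j)"
      using one by (simp flip: sum_distrib_left sum_distrib_right)
    finally show ?thesis using that v by (simp add: index_ket_bra)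
  qed
  then have "ket_bra v * ket_bra v = ket_bra v" using ket_bra_carrier[OF v] by (intro eq_matI) auto
  moreover have "hermitian_op n (ket_bra v)"
    using v by (auto simp: hermitian_op_iff index_ket_bra ket_bra_carrier)
  ultimately show ?thesis by (simp add: orth_projector_def)
qed

text \<open>Let u be a normalised nonzero column of P. Idempotence gives P u = u, and rank one makes
  column i a multiple a_i u. Pairing with u and using Hermiticity gives a_i = cnj ((P u)_i) = cnj
  (u_i). Conversely, entries of product form bound the rank by 1, and a nonzero column bounds it
  from below.\<close>

lemma rank1_projector_iff:
  "rank1_projector n P \<longleftrightarrow> (\<exists>v. unit_vector n v \<and> P = ket_bra v)"
proof
  interpret vec_space "TYPE(complex)" n .
  assume rP: "rank1_projector n P"
  then have oP: "orth_projector n P" and r: "rank P = 1" by (auto simp: rank1_projector_def)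
  then have P: "P \<in> carrier_mat n n" and PP: "P * P = P"
    by (auto simp: orth_projector_def hermitian_op_def)
  have "\<exists>j<n. col P j \<noteq> 0\<^sub>v n"
  proof (rule ccontr)
    assume "\<not> ?thesis"
    then have z: "\<And>j. j < n \<Longrightarrow> col P j = 0\<^sub>v n" by blast
    have "P $$ (i, j) = 0" if "i < n" "j < n" for i j
      using arg_cong[OF z[OF that(2)], of "\<lambda>v. v $ i"] that P by simp
    then have "P = 0\<^sub>m n n" using P by (intro eq_matI) auto
    with r rank_0I[of n] show False by simp
  qed
  then obtain j where j: "j < n" "col P j \<noteq> 0\<^sub>v n" by blast
  have "col P j \<in> carrier_vec n" using P by auto
  from nonzero_vec_eq_smult_unit[OF this j(2)] obtain t u where
    t: "0 < t" and u: "unit_vector n u" and col: "col P j = complex_of_real t \<cdot>\<^sub>v u" by blast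
  have uc: "u \<in> carrier_vec n" using u by (rule unit_vectorD)
  have "P *\<^sub>v col P j = col (P * P) j" by (rule col_mult2[OF P P j(1), symmetric])
  then have "P *\<^sub>v (complex_of_real t \<cdot>\<^sub>v u) = complex_of_real t \<cdot>\<^sub>v u" by (simp add: PP col)
  then have "complex_of_real t \<cdot>\<^sub>v (P *\<^sub>v u) = complex_of_real t \<cdot>\<^sub>v u"
    using P uc by (simp add: mult_mat_vec)
  then have Pu: "P *\<^sub>v u = u" using t P uc by (auto simp: vec_eq_iff)
  have "\<exists>a. \<forall>k<n. P $$ (k, i) = a * u $ k" if i: "i < n" for i
  proof -
    from rank_le_1_imp_cols_proportional[OF P _ j i] r obtain a where
      "col P i = a \<cdot>\<^sub>v (complex_of_real t \<cdot>\<^sub>v u)" by (auto simp: col)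
    then have "col P i $ k = a * t * u $ k" if "k < n" for k using uc that by simp
    then show ?thesis using P i by (intro exI[of _ "a * t"]) simp
  qed
  then obtain a where a: "\<And>i k. i < n \<Longrightarrow> k < n \<Longrightarrow> P $$ (k, i) = a i * u $ k" by metis
  have one: "(\<Sum>k<n. u $ k * cnj (u $ k)) = 1"
    using u cscalar_prod_sum[OF uc uc] by (simp add: unit_vector_def)
  have "a i = cnj (u $ i)" if i: "i < n" for i
  proof -
    have H: "cnj (P $$ (k, i)) = P $$ (i, k)" if "k < n" for k
      using oP i that unfolding orth_projector_def hermitian_op_iff by metis
    have "a i = (\<Sum>k<n. a i * u $ k * cnj (u $ k))"
      using one by (simp add: mult.assoc flip: sum_distrib_left)
    also have "\<dots> = cnj (\<Sum>k<n. P $$ (i, k) * u $ k)"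
      unfolding cnj_sum
    proof (intro sum.cong refl)
      fix k assume "k \<in> {..<n}"
      then have "cnj (P $$ (i, k)) = a i * u $ k" using H[of k] a[OF i, of k] by (metis complex_cnj_cnj lessThan_iff)
      then show "a i * u $ k * cnj (u $ k) = cnj (P $$ (i, k) * u $ k)" by simp
    qed
    also have "\<dots> = cnj (u $ i)" using Pu index_mult_mat_vec_sum[OF P uc i] by simp
    finally show ?thesis .
  qed
  then have "P = ket_bra u" using P uc ket_bra_carrier[OF uc]
    by (intro eq_matI) (auto simp: a index_ket_bra)
  with u show "\<exists>v. unit_vector n v \<and> P = ket_bra v" by blast
next
  interpret vec_space "TYPE(complex)" n .
  assume "\<exists>v. unit_vector n v \<and> P = ket_bra v"
  then obtain v where v: "unit_vector n v" and P: "P = ket_bra v" by blast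
  have vc: "v \<in> carrier_vec n" using v by (rule unit_vectorD)
  have Pc: "P \<in> carrier_mat n n" using vc by (simp add: P ket_bra_carrier)
  have "rank P \<le> 1"
    by (rule rank_le_1_product_entries[OF Pc, of "\<lambda>i. v $ i" "\<lambda>i. cnj (v $ i)"])
       (use Pc vc in \<open>auto simp: P index_ket_bra\<close>)
  moreover have "v \<noteq> 0\<^sub>v n" using v by (auto simp: unit_vector_def)
  then obtain j where j: "j < n" "v $ j \<noteq> 0" using vc by (auto simp: vec_eq_iff)
  have "col P j $ j \<noteq> 0" using j vc Pc by (simp add: P index_ket_bra)
  then have "col P j \<noteq> 0\<^sub>v n" using j by auto
  then have "1 \<le> rank P" by (rule col_nonzero_imp_rank_pos[OF Pc j(1)])
  ultimately show "rank1_projector n P"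
    using orth_projector_ket_bra[OF v] by (simp add: rank1_projector_def P)
qed

section \<open>Kronecker products of rank-one and of positive operators\<close>

lemma kron_mat_carrier:
  "A \<in> carrier_mat d d \<Longrightarrow> B \<in> carrier_mat m m \<Longrightarrow> kron_mat A B \<in> carrier_mat (d * m) (d * m)"
  by (auto simp: kron_mat_def)

lemma index_kron_mat:
  assumes "A \<in> carrier_mat d d" "B \<in> carrier_mat m m" "a < d" "b < m" "a' < d" "b' < m"
  shows "kron_mat A B $$ (a * m + b, a' * m + b') = A $$ (a, a') * B $$ (b, b')"
  using assms mult_add_less_mult[OF assms(3,4)] mult_add_less_mult[OF assms(5,6)]
  by (auto simp: kron_mat_def)

lemma tensor_mat_Cons: "tensor_mat (A # As) = kron_mat A (tensor_mat As)"
  by (simp add: tensor_mat_def)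

lemma tensor_mat_carrier:
  assumes "list_all2 (\<lambda>d A. A \<in> carrier_mat d d) ds As"
  shows "tensor_mat As \<in> carrier_mat (prod_list ds) (prod_list ds)"
  using assms
  by induction (auto simp: tensor_mat_Cons intro: kron_mat_carrier, simp_all add: tensor_mat_def)

lemma kron_mat_ket_bra:
  assumes v: "v \<in> carrier_vec d" and w: "w \<in> carrier_vec m"
  shows "kron_mat (ket_bra v) (ket_bra w) = ket_bra (kron_vec v w)"
proof (rule eq_matI)
  fix i j assume "i < dim_row (ket_bra (kron_vec v w))" "j < dim_col (ket_bra (kron_vec v w))"
  then have ij: "i < d * m" "j < d * m"
    using ket_bra_carrier[OF kron_vec_carrier[OF v w]] by auto
  from ij(1) obtain a b where a: "a < d" "b < m" "i = a * m + b" by (rule less_mult_split)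
  from ij(2) obtain a' b' where b: "a' < d" "b' < m" "j = a' * m + b'" by (rule less_mult_split)
  show "kron_mat (ket_bra v) (ket_bra w) $$ (i, j) = ket_bra (kron_vec v w) $$ (i, j)"
    unfolding index_ket_bra[OF kron_vec_carrier[OF v w] ij]
    using a b v w by (simp add: index_kron_vec[OF v w] index_ket_bra
        index_kron_mat[OF ket_bra_carrier[OF v] ket_bra_carrier[OF w]])
qed (use ket_bra_carrier[OF kron_vec_carrier[OF v w]]
      kron_mat_carrier[OF ket_bra_carrier[OF v] ket_bra_carrier[OF w]] in auto)

lemma tensor_mat_ket_bra:
  assumes "list_all2 (\<lambda>d v. v \<in> carrier_vec d) ds vs"
  shows "tensor_mat (map ket_bra vs) = ket_bra (tensor_vec vs)"
  using assms
proof induction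
  case Nil
  show ?case by (auto simp: tensor_mat_def tensor_vec_def ket_bra_def)
next
  case (Cons d ds v vs)
  then show ?case
    using kron_mat_ket_bra[OF _ tensor_vec_carrier[OF Cons.hyps(2)]]
    by (simp add: tensor_mat_Cons tensor_vec_Cons)
qed

lemma list_all2_rank1_projector:
  assumes "list_all2 rank1_projector ds Ps"
  shows "\<exists>vs. list_all2 unit_vector ds vs \<and> Ps = map ket_bra vs"
  using assms
proof induction
  case (Cons d ds P Ps)
  then obtain v vs where "unit_vector d v" "P = ket_bra v" "list_all2 unit_vector ds vs" "Ps = map ket_bra vs"
    by (auto simp: rank1_projector_iff)
  then show ?case by (intro exI[of _ "v # vs"]) simp
qed simp

lemma mat_trace_mult_tensor_ket_bra:
  assumes "A \<in> carrier_mat (prod_list ds) (prod_list ds)" "list_all2 unit_vector ds vs"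
  shows "mat_trace (A * tensor_mat (map ket_bra vs)) = expval (tensor_vec vs) A"
proof -
  have "list_all2 (\<lambda>d v. v \<in> carrier_vec d) ds vs"
    using assms(2) by (rule list_all2_mono) (rule unit_vectorD)
  then show ?thesis using assms(1)
    by (simp add: tensor_mat_ket_bra mat_trace_mult_ket_bra[OF _ tensor_vec_carrier])
qed

text \<open>This turns the extremal problems over rank-one projectors into extremal problems over
  unit product vectors, where compactness applies.\<close>

lemma product_values_eq:
  assumes "A \<in> carrier_mat (prod_list ds) (prod_list ds)"
  shows "product_values ds A = {Re (expval (tensor_vec vs) A) |vs. list_all2 unit_vector ds vs}"
proof -
  have "list_all2 rank1_projector ds (map ket_bra vs)" if "list_all2 unit_vector ds vs" for vs
    using that by (auto simp: list_all2_map2 rank1_projector_iff elim!: list_all2_mono)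
  moreover have "Re (mat_trace (A * tensor_mat (map ket_bra vs))) = Re (expval (tensor_vec vs) A)"
    if "list_all2 unit_vector ds vs" for vs
    using mat_trace_mult_tensor_ket_bra[OF assms that] by simp
  ultimately show ?thesis unfolding product_values_def
    using list_all2_rank1_projector by (blast intro: sym)
qed

text \<open>Multiplying out the rank-one decompositions of the factors produces product vectors
  only. They are not normalised and may be 0.\<close>

lemma tensor_psd_ket_bra_decomp:
  assumes "list_all2 psd ds Rs"
  shows "\<exists>W. (\<forall>vs\<in>set W. list_all2 (\<lambda>d v. v \<in> carrier_vec d) ds vs) \<and>
    (\<forall>i<prod_list ds. \<forall>j<prod_list ds.
       tensor_mat Rs $$ (i, j) = (\<Sum>vs\<leftarrow>W. tensor_vec vs $ i * cnj (tensor_vec vs $ j)))"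
  using assms
proof induction
  case Nil
  show ?case by (intro exI[of _ "[[]]"]) (simp add: tensor_mat_def tensor_vec_def)
next
  case (Cons d ds R Rs)
  from Cons.IH obtain W where W: "\<And>vs. vs \<in> set W \<Longrightarrow> list_all2 (\<lambda>d v. v \<in> carrier_vec d) ds vs"
    "\<And>i j. i < prod_list ds \<Longrightarrow> j < prod_list ds \<Longrightarrow>
       tensor_mat Rs $$ (i, j) = (\<Sum>vs\<leftarrow>W. tensor_vec vs $ i * cnj (tensor_vec vs $ j))" by blast
  from psd_ket_bra_decomp[OF Cons.hyps(1)] obtain ws where ws: "set ws \<subseteq> carrier_vec d"
    "\<And>i j. i < d \<Longrightarrow> j < d \<Longrightarrow> R $$ (i, j) = (\<Sum>w\<leftarrow>ws. w $ i * cnj (w $ j))" by blast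
  have R: "R \<in> carrier_mat d d" using Cons.hyps(1) by (simp add: psd_def)
  have T: "tensor_mat Rs \<in> carrier_mat (prod_list ds) (prod_list ds)"
    using Cons.hyps(2) by (intro tensor_mat_carrier) (auto elim!: list_all2_mono simp: psd_def)
  \<comment> \<open>All lists formed from a term \<open>w\<close> of the first factor and a product
    term \<open>vs\<close> of the others, ordered so that the product of the two sums is one sum
    over this list.\<close>
  define W' where "W' = concat (map (\<lambda>w. map ((#) w) W) ws)"
  have prod: "(\<Sum>w\<leftarrow>ws. f w) * (\<Sum>vs\<leftarrow>W. g vs) = (\<Sum>us\<leftarrow>W'. f (hd us) * g (tl us))"
    for f :: "complex vec \<Rightarrow> complex" and g
    unfolding W'_def
    by (induction ws) (simp_all add: ring_distribs sum_list_const_mult o_def)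
  show ?case
  proof (intro exI[of _ W'] conjI ballI allI impI)
    fix us assume "us \<in> set W'"
    then show "list_all2 (\<lambda>d v. v \<in> carrier_vec d) (d # ds) us"
      using ws W by (auto simp: W'_def)
  next
    fix i j assume ij: "i < prod_list (d # ds)" "j < prod_list (d # ds)"
    from ij(1) obtain a b where a: "a < d" "b < prod_list ds" "i = a * prod_list ds + b"
      by (auto elim: less_mult_split)
    from ij(2) obtain a' b' where b: "a' < d" "b' < prod_list ds" "j = a' * prod_list ds + b'"
      by (auto elim: less_mult_split)
    have "tensor_mat (R # Rs) $$ (i, j) = R $$ (a, a') * tensor_mat Rs $$ (b, b')"
      unfolding tensor_mat_Cons a b by (rule index_kron_mat[OF R T a(1,2) b(1,2)])
    also have "\<dots> = (\<Sum>us\<leftarrow>W'. (hd us $ a * cnj (hd us $ a'))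
         * (tensor_vec (tl us) $ b * cnj (tensor_vec (tl us) $ b')))"
      unfolding ws(2)[OF a(1) b(1)] W(2)[OF a(2) b(2)] by (rule prod)
    also have "\<dots> = (\<Sum>us\<leftarrow>W'. tensor_vec us $ i * cnj (tensor_vec us $ j))"
    proof (intro arg_cong[where f = sum_list] map_cong refl)
      fix us assume "us \<in> set W'"
      then obtain w vs where us: "us = w # vs" "w \<in> set ws" "vs \<in> set W" by (auto simp: W'_def)
      have w: "w \<in> carrier_vec d" using ws us by auto
      note ind = index_kron_vec[OF w tensor_vec_carrier[OF W(1)[OF us(3)]]]
      show "(hd us $ a * cnj (hd us $ a')) * (tensor_vec (tl us) $ b * cnj (tensor_vec (tl us) $ b'))
          = tensor_vec us $ i * cnj (tensor_vec us $ j)"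
        using ind[OF a(1,2)] ind[OF b(1,2)] by (simp add: us(1) tensor_vec_Cons a b)
    qed
    finally show "tensor_mat (R # Rs) $$ (i, j) = (\<Sum>us\<leftarrow>W'. tensor_vec us $ i * cnj (tensor_vec us $ j))" .
  qed
qed

section \<open>Operators that are nonnegative on product vectors\<close>

definition block_positive :: "nat list \<Rightarrow> complex mat \<Rightarrow> bool" where
  "block_positive ds A \<longleftrightarrow> A \<in> carrier_mat (prod_list ds) (prod_list ds) \<and>
     (\<forall>vs. list_all2 unit_vector ds vs \<longrightarrow> 0 \<le> expval (tensor_vec vs) A)"

lemma tensor_vec_eq_smult_units:
  assumes "list_all2 (\<lambda>d v. v \<in> carrier_vec d) ds vs" "\<forall>d\<in>set ds. 0 < d"
  shows "\<exists>t us. list_all2 unit_vector ds us \<and> tensor_vec vs = complex_of_real t \<cdot>\<^sub>v tensor_vec us"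
  using assms
proof induction
  case Nil
  show ?case by (intro exI[of _ 1] exI[of _ "[]"]) simp
next
  case (Cons d ds v vs)
  then obtain t us where us: "list_all2 unit_vector ds us" "tensor_vec vs = complex_of_real t \<cdot>\<^sub>v tensor_vec us"
    by auto
  have "\<exists>s u. unit_vector d u \<and> v = complex_of_real s \<cdot>\<^sub>v u"
  proof (cases "v = 0\<^sub>v d")
    case True
    then show ?thesis using Cons.prems
      by (intro exI[of _ 0] exI[of _ "unit_vec d 0"]) (auto simp: unit_vector_unit_vec)
  next
    case False
    with nonzero_vec_eq_smult_unit[OF Cons.hyps(1)] show ?thesis by blast
  qed
  then obtain s u where s: "unit_vector d u" "v = complex_of_real s \<cdot>\<^sub>v u" by blast
  have tu: "tensor_vec us \<in> carrier_vec (prod_list ds)" by (rule unit_vectors_tensor_carrier[OF us(1)])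
  have "kron_vec v (tensor_vec vs) = complex_of_real (s * t) \<cdot>\<^sub>v kron_vec u (tensor_vec us)" (is "?l = ?r")
  proof (rule eq_vecI)
    fix i assume "i < dim_vec ?r"
    then have "i < d * prod_list ds" using kron_vec_carrier[OF unit_vectorD[OF s(1)] tu] by auto
    then obtain a b where ab: "a < d" "b < prod_list ds" "i = a * prod_list ds + b" by (rule less_mult_split)
    have "?l $ i = v $ a * tensor_vec vs $ b" unfolding ab
      by (rule index_kron_vec[OF Cons.hyps(1) tensor_vec_carrier[OF Cons.hyps(2)] ab(1,2)])
    moreover have "kron_vec u (tensor_vec us) $ i = u $ a * tensor_vec us $ b" unfolding ab
      by (rule index_kron_vec[OF unit_vectorD[OF s(1)] tu ab(1,2)])
    ultimately show "?l $ i = ?r $ i"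
      using \<open>i < dim_vec ?r\<close> ab tu unit_vectorD[OF s(1)] by (simp add: s(2) us(2))
  qed (simp add: kron_vec_def s(2) us(2))
  then show ?case
    using us s Cons.hyps(1) by (intro exI[of _ "s * t"] exI[of _ "u # us"]) (auto simp: tensor_vec_Cons)
qed

lemma block_positive_expval_tensor:
  assumes "block_positive ds A" "\<forall>d\<in>set ds. 0 < d" "list_all2 (\<lambda>d v. v \<in> carrier_vec d) ds vs"
  shows "0 \<le> expval (tensor_vec vs) A"
proof -
  from tensor_vec_eq_smult_units[OF assms(3,2)] obtain t us where
    us: "list_all2 unit_vector ds us" "tensor_vec vs = complex_of_real t \<cdot>\<^sub>v tensor_vec us" by blast
  have A: "A \<in> carrier_mat (prod_list ds) (prod_list ds)" and "0 \<le> expval (tensor_vec us) A"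
    using assms(1) us(1) by (auto simp: block_positive_def)
  then show ?thesis unfolding us(2) expval_scaled[OF A unit_vectors_tensor_carrier[OF us(1)]]
    by (intro mult_nonneg_nonneg cnj_mult_self_nonneg)
qed

lemma mat_trace_mult_sum_ket_bra:
  assumes A: "A \<in> carrier_mat n n" and X: "X \<in> carrier_mat n n" and ws: "set ws \<subseteq> carrier_vec n"
    and Xij: "\<And>i j. i < n \<Longrightarrow> j < n \<Longrightarrow> X $$ (i, j) = (\<Sum>w\<leftarrow>ws. w $ i * cnj (w $ j))"
  shows "mat_trace (A * X) = (\<Sum>w\<leftarrow>ws. expval w A)"
proof -
  have "mat_trace (A * X) = (\<Sum>i<n. \<Sum>j<n. A $$ (i, j) * (\<Sum>w\<leftarrow>ws. w $ j * cnj (w $ i)))"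
    unfolding mat_trace_mult[OF A X] by (intro sum.cong refl) (simp add: Xij)
  also have "\<dots> = (\<Sum>w\<leftarrow>ws. expval w A)"
    using ws
  proof (induction ws)
    case (Cons w ws)
    then have "expval w A = (\<Sum>i<n. \<Sum>j<n. A $$ (i, j) * (w $ j * cnj (w $ i)))"
      using A by (simp add: expval_sum mult_ac)
    with Cons show ?case by (simp add: ring_distribs sum.distrib)
  qed simp
  finally show ?thesis .
qed

text \<open>The trace expands into values of A at product vectors, each a nonnegative multiple of a
  value at a unit product vector. This one fact serves separable states, products of projectors, and
  the identity operator.\<close>

lemma block_positive_mat_trace:
  assumes "block_positive ds A" "\<forall>d\<in>set ds. 0 < d" "list_all2 psd ds Rs"
  shows "0 \<le> mat_trace (A * tensor_mat Rs)"
proof -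
  have A: "A \<in> carrier_mat (prod_list ds) (prod_list ds)" using assms(1) by (simp add: block_positive_def)
  have T: "tensor_mat Rs \<in> carrier_mat (prod_list ds) (prod_list ds)"
    using assms(3) by (intro tensor_mat_carrier) (auto elim!: list_all2_mono simp: psd_def)
  from tensor_psd_ket_bra_decomp[OF assms(3)] obtain W where
    W: "\<And>vs. vs \<in> set W \<Longrightarrow> list_all2 (\<lambda>d v. v \<in> carrier_vec d) ds vs"
    "\<And>i j. i < prod_list ds \<Longrightarrow> j < prod_list ds \<Longrightarrow>
       tensor_mat Rs $$ (i, j) = (\<Sum>vs\<leftarrow>W. tensor_vec vs $ i * cnj (tensor_vec vs $ j))" by blast
  have "mat_trace (A * tensor_mat Rs) = (\<Sum>w\<leftarrow>map tensor_vec W. expval w A)"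
    using W by (intro mat_trace_mult_sum_ket_bra[OF A T]) (auto simp: o_def intro: tensor_vec_carrier)
  also have "\<dots> \<ge> 0"
    using block_positive_expval_tensor[OF assms(1,2) W(1)] by (intro sum_list_nonneg) auto
  finally show ?thesis .
qed

lemma block_positive_separable:
  assumes bp: "block_positive ds A" and ds: "\<forall>d\<in>set ds. 0 < d" and sep: "separable ds \<sigma>"
  shows "0 \<le> mat_trace (A * \<sigma>)"
proof -
  let ?N = "prod_list ds"
  have A: "A \<in> carrier_mat ?N ?N" using bp by (simp add: block_positive_def)
  from sep obtain n :: nat and p :: "nat \<Rightarrow> real" and R where
    p: "\<And>k. k < n \<Longrightarrow> 0 \<le> p k \<and> list_all2 density_op ds (R k)"
    and \<sigma>: "\<sigma> = mat ?N ?N (\<lambda>(i, j). \<Sum>k<n. complex_of_real (p k) * tensor_mat (R k) $$ (i, j))"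
    unfolding separable_def by blast
  have psd: "list_all2 psd ds (R k)" if "k < n" for k
    using p[OF that] by (auto elim!: list_all2_mono simp: density_op_def positive_op_iff_psd)
  have T: "tensor_mat (R k) \<in> carrier_mat ?N ?N" if "k < n" for k
    using psd[OF that] by (intro tensor_mat_carrier) (auto elim!: list_all2_mono simp: psd_def)
  have \<sigma>c: "\<sigma> \<in> carrier_mat ?N ?N" by (simp add: \<sigma>)
  have "mat_trace (A * \<sigma>) = (\<Sum>i<?N. \<Sum>j<?N. \<Sum>k<n. p k * (A $$ (i, j) * tensor_mat (R k) $$ (j, i)))"
    unfolding mat_trace_mult[OF A \<sigma>c] by (simp add: \<sigma> sum_distrib_left mult_ac)
  also have "\<dots> = (\<Sum>i<?N. \<Sum>k<n. \<Sum>j<?N. p k * (A $$ (i, j) * tensor_mat (R k) $$ (j, i)))"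
    by (intro sum.cong refl sum.swap)
  also have "\<dots> = (\<Sum>k<n. \<Sum>i<?N. \<Sum>j<?N. p k * (A $$ (i, j) * tensor_mat (R k) $$ (j, i)))"
    by (rule sum.swap)
  also have "\<dots> = (\<Sum>k<n. p k * mat_trace (A * tensor_mat (R k)))"
    by (intro sum.cong refl) (simp add: mat_trace_mult[OF A T] sum_distrib_left)
  also have "\<dots> \<ge> 0"
    using p block_positive_mat_trace[OF bp ds psd]
    by (intro sum_nonneg mult_nonneg_nonneg) (auto simp: less_eq_complex_def)
  finally show ?thesis .
qed

subsection \<open>The map corresponding to an operator\<close>

lemma hs_inner_sum:
  assumes "X \<in> carrier_mat m n" "Y \<in> carrier_mat m n"
  shows "mat_trace (mat_adjoint X * Y) = (\<Sum>a<m. \<Sum>b<n. cnj (X $$ (a, b)) * Y $$ (a, b))"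
  unfolding mat_trace_mult[OF mat_adjoint_carrier[OF assms(1)] assms(2)]
  by (subst sum.swap) (simp add: index_mat_adjoint[OF assms(1)])

lemma sum_swap_pairs:
  fixes f :: "nat \<Rightarrow> nat \<Rightarrow> nat \<Rightarrow> nat \<Rightarrow> 'a::comm_monoid_add"
  shows "(\<Sum>i<p. \<Sum>j<q. \<Sum>a<r. \<Sum>b<s. f i j a b) = (\<Sum>a<r. \<Sum>b<s. \<Sum>i<p. \<Sum>j<q. f i j a b)"
proof -
  have "(\<Sum>i<p. \<Sum>j<q. \<Sum>a<r. \<Sum>b<s. f i j a b) = (\<Sum>i<p. \<Sum>a<r. \<Sum>j<q. \<Sum>b<s. f i j a b)"
    by (intro sum.cong refl sum.swap)
  also have "\<dots> = (\<Sum>a<r. \<Sum>i<p. \<Sum>j<q. \<Sum>b<s. f i j a b)" by (rule sum.swap)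
  also have "\<dots> = (\<Sum>a<r. \<Sum>i<p. \<Sum>b<s. \<Sum>j<q. f i j a b)"
    by (intro sum.cong refl sum.swap)
  also have "\<dots> = (\<Sum>a<r. \<Sum>b<s. \<Sum>i<p. \<Sum>j<q. f i j a b)"
    by (intro sum.cong refl sum.swap)
  finally show ?thesis .
qed

text \<open>A unitary change of coordinates followed by its inverse: the inner sums are the entries
  of \<open>conj(U) F U^T\<close>, the outer ones multiply by \<open>U^T\<close> on the left and
  \<open>conj(U)\<close> on the right. It drives the uniqueness of the map, the recovery of the
  blocks of A, and the trace formula for \<Psi>.\<close>

lemma double_sum_unitary:
  fixes U :: "nat \<Rightarrow> nat \<Rightarrow> complex"
  assumes U: "\<And>a b. a < d \<Longrightarrow> b < d \<Longrightarrow> (\<Sum>i<d. U i a * cnj (U i b)) = (if a = b then 1 else 0)"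
    and pq: "p < d" "q < d"
  shows "(\<Sum>i<d. \<Sum>j<d. U i p * cnj (U j q) * (\<Sum>a<d. \<Sum>b<d. cnj (U i a) * U j b * F a b)) = F p q"
proof -
  have "(\<Sum>i<d. \<Sum>j<d. U i p * cnj (U j q) * (\<Sum>a<d. \<Sum>b<d. cnj (U i a) * U j b * F a b))
      = (\<Sum>i<d. \<Sum>j<d. \<Sum>a<d. \<Sum>b<d. (U i p * cnj (U i a)) * (U j b * cnj (U j q)) * F a b)"
    by (simp add: sum_distrib_left mult_ac)
  also have "\<dots> = (\<Sum>a<d. \<Sum>b<d. \<Sum>i<d. \<Sum>j<d. (U i p * cnj (U i a)) * (U j b * cnj (U j q)) * F a b)"
    by (rule sum_swap_pairs)
  also have "\<dots> = (\<Sum>a<d. \<Sum>b<d. (\<Sum>i<d. U i p * cnj (U i a)) * (\<Sum>j<d. U j b * cnj (U j q)) * F a b)"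
    unfolding sum_product by (simp only: sum_distrib_right)
  also have "\<dots> = (\<Sum>a<d. \<Sum>b<d. if a = p \<and> b = q then F p q else 0)"
    using pq by (intro sum.cong refl) (auto simp: U)
  also have "\<dots> = (\<Sum>a<d. if a = p then F p q else 0)"
    using pq by (intro sum.cong refl) auto
  also have "\<dots> = F p q" using pq by simp
  finally show ?thesis .
qed

text \<open>
  The maximally entangled vector is \<open>\<Sum>\<^sub>i |i\<rangle> \<otimes> |g\<^sub>i\<rangle>\<close> over the standard basis, where
  \<open>g\<^sub>i\<close> has the entries \<open>basis_gram d e i a\<close>: these form the matrix \<open>E E\<^sup>T\<close> for the unitary
  \<open>E\<close> with columns \<open>e k\<close>, which is unitary and symmetric.
\<close>
definition basis_gram :: "nat \<Rightarrow> (nat \<Rightarrow> complex vec) \<Rightarrow> nat \<Rightarrow> nat \<Rightarrow> complex" where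
  "basis_gram d e i a = (\<Sum>k<d. e k $ i * e k $ a)"

lemma basis_gram_sym: "basis_gram d e i a = basis_gram d e a i"
  by (simp add: basis_gram_def mult.commute)

text \<open>Orthonormality says that the adjoint of E is a left inverse of E; for square matrices it
  is then a right inverse, which is the completeness relation.\<close>

lemma orthonormal_basis_complete:
  assumes "orthonormal_basis d e" "i < d" "j < d"
  shows "(\<Sum>k<d. e k $ i * cnj (e k $ j)) = (if i = j then 1 else 0)"
proof -
  define E where "E = mat d d (\<lambda>(i, k). e k $ i)"
  have E: "E \<in> carrier_mat d d" by (simp add: E_def)
  have c: "e k \<in> carrier_vec d" if "k < d" for k using assms(1) that by (simp add: orthonormal_basis_def)
  have Eik: "E $$ (i, k) = e k $ i" if "i < d" "k < d" for i k using that by (simp add: E_def)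
  have "(mat_adjoint E * E) $$ (k, l) = 1\<^sub>m d $$ (k, l)" if kl: "k < d" "l < d" for k l
  proof -
    have "(mat_adjoint E * E) $$ (k, l) = (\<Sum>i<d. e l $ i * cnj (e k $ i))"
      using kl E mat_adjoint_carrier[OF E]
      by (auto simp: scalar_prod_def lessThan_atLeast0 index_mat_adjoint[OF E] Eik mult.commute intro!: sum.cong)
    also have "\<dots> = e l \<bullet>c e k" by (rule cscalar_prod_sum[OF c[OF kl(2)] c[OF kl(1)], symmetric])
    finally show ?thesis using assms(1) kl by (auto simp: orthonormal_basis_def)
  qed
  then have "mat_adjoint E * E = 1\<^sub>m d" using E mat_adjoint_carrier[OF E] by (intro eq_matI) auto
  then have "E * mat_adjoint E = 1\<^sub>m d"
    by (rule mat_mult_left_right_inverse[OF mat_adjoint_carrier[OF E] E])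
  moreover have "(E * mat_adjoint E) $$ (i, j) = (\<Sum>k<d. e k $ i * cnj (e k $ j))"
    using assms(2,3) E mat_adjoint_carrier[OF E]
    by (auto simp: scalar_prod_def lessThan_atLeast0 index_mat_adjoint[OF E] Eik intro!: sum.cong)
  ultimately show ?thesis using assms(2,3) by simp
qed

text \<open>Both relations of the unitary E enter: the sum over \<open>i\<close> collapses by
  orthonormality, and what remains is the completeness relation.\<close>

lemma basis_gram_unitary:
  assumes e: "orthonormal_basis d e" and ab: "a < d" "b < d"
  shows "(\<Sum>i<d. basis_gram d e i a * cnj (basis_gram d e i b)) = (if a = b then 1 else 0)"
proof -
  have c: "e k \<in> carrier_vec d" if "k < d" for k using e that by (simp add: orthonormal_basis_def)
  have "(\<Sum>i<d. basis_gram d e i a * cnj (basis_gram d e i b))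
      = (\<Sum>i<d. \<Sum>k<d. \<Sum>l<d. e k $ a * cnj (e l $ b) * (e k $ i * cnj (e l $ i)))"
    by (simp add: basis_gram_def sum_product mult_ac)
  also have "\<dots> = (\<Sum>k<d. \<Sum>i<d. \<Sum>l<d. e k $ a * cnj (e l $ b) * (e k $ i * cnj (e l $ i)))"
    by (rule sum.swap)
  also have "\<dots> = (\<Sum>k<d. \<Sum>l<d. \<Sum>i<d. e k $ a * cnj (e l $ b) * (e k $ i * cnj (e l $ i)))"
    by (intro sum.cong refl sum.swap)
  also have "\<dots> = (\<Sum>k<d. \<Sum>l<d. if l = k then e k $ a * cnj (e k $ b) else 0)"
  proof (intro sum.cong refl)
    fix k l assume "k \<in> {..<d}" "l \<in> {..<d}"
    then have kl: "k < d" "l < d" by auto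
    have "(\<Sum>i<d. e k $ i * cnj (e l $ i)) = (if k = l then 1 else 0)"
      using cscalar_prod_sum[OF c[OF kl(1)] c[OF kl(2)]] e kl by (simp add: orthonormal_basis_def)
    then show "(\<Sum>i<d. e k $ a * cnj (e l $ b) * (e k $ i * cnj (e l $ i)))
      = (if l = k then e k $ a * cnj (e k $ b) else 0)" by (simp flip: sum_distrib_left)
  qed
  also have "\<dots> = (\<Sum>k<d. e k $ a * cnj (e k $ b))"
    by simp
  finally show ?thesis using orthonormal_basis_complete[OF e ab] by simp
qed

section \<open>Blocks of |\<Psi>><\<Psi>| and the map they determine\<close>

lemma max_entangled_vec_carrier: "max_entangled_vec d e \<in> carrier_vec (d * d)"
  by (simp add: max_entangled_vec_def)

lemma index_max_entangled_vec:
  assumes "orthonormal_basis d e" "i < d" "a < d"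
  shows "max_entangled_vec d e $ (i * d + a) = basis_gram d e i a"
  using assms mult_add_less_mult[OF assms(2,3)]
  by (auto simp: max_entangled_vec_def basis_gram_def orthonormal_basis_def index_kron_vec[of _ d _ d]
      intro!: sum.cong)

text \<open>This is |g_i><g_j|, the (i, j) block of |\<Psi>><\<Psi>|. For the standard basis it is
  the matrix unit at (i, j).\<close>

definition gram_ket_bra :: "nat \<Rightarrow> (nat \<Rightarrow> complex vec) \<Rightarrow> nat \<Rightarrow> nat \<Rightarrow> complex mat" where
  "gram_ket_bra d e i j = mat d d (\<lambda>(a, b). basis_gram d e i a * cnj (basis_gram d e j b))"

lemma gram_ket_bra_carrier: "gram_ket_bra d e i j \<in> carrier_mat d d"
  by (simp add: gram_ket_bra_def)

lemma index_id_tensor_max_entangled: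
  assumes e: "orthonormal_basis d e" and "i < d" "j < d" "x < m" "y < m"
  shows "id_tensor d d m M (ket_bra (max_entangled_vec d e)) $$ (i * m + x, j * m + y)
    = M (gram_ket_bra d e i j) $$ (x, y)"
proof -
  have "mat d d (\<lambda>(a, b). ket_bra (max_entangled_vec d e) $$ (i * d + a, j * d + b)) = gram_ket_bra d e i j"
    using assms by (intro eq_matI) (auto simp: gram_ket_bra_def index_max_entangled_vec
        index_ket_bra[OF max_entangled_vec_carrier] mult_add_less_mult)
  then show ?thesis using assms by (simp add: id_tensor_def mult_add_less_mult)
qed

text \<open>
  \<open>A = (I \<otimes> L\<^sup>\<dagger>) (|\<Psi>\<rangle>\<langle>\<Psi>|)\<close> says that the \<open>(i, j)\<close> block of \<open>A\<close> is \<open>L\<^sup>\<dagger> (|g\<^sub>i\<rangle>\<langle>g\<^sub>j|)\<close>,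
  so \<open>\<langle>g\<^sub>i| L Y |g\<^sub>j\<rangle>\<close> is the Hilbert--Schmidt product of that block with \<open>Y\<close>, written
  \<open>choi_coeff m A i j Y\<close>. This determines \<open>L\<close>.
\<close>
definition choi_coeff :: "nat \<Rightarrow> complex mat \<Rightarrow> nat \<Rightarrow> nat \<Rightarrow> complex mat \<Rightarrow> complex" where
  "choi_coeff m A i j Y = (\<Sum>x<m. \<Sum>y<m. cnj (A $$ (i * m + x, j * m + y)) * Y $$ (x, y))"

text \<open>The numbers \<open>choi_coeff m A i j Y\<close> prescribe the matrix elements <g_i|L
  Y|g_j>. As the g_i form an orthonormal basis, L Y must be the sum of these numbers times
  |g_i><g_j|. The restriction to the carrier matches the extensionality built into
  \<open>linear_superop\<close>.\<close>

definition choi_map :: "nat \<Rightarrow> nat \<Rightarrow> (nat \<Rightarrow> complex vec) \<Rightarrow> complex mat \<Rightarrow> complex mat \<Rightarrow> complex mat" where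
  "choi_map d m e A = (\<lambda>Y\<in>carrier_mat m m. mat d d (\<lambda>(a, b). \<Sum>i<d. \<Sum>j<d.
      basis_gram d e i a * cnj (basis_gram d e j b) * choi_coeff m A i j Y))"

text \<open>Testing the adjoint relation against |g_i><g_j| identifies the matrix elements of L Y in
  the basis g with \<open>choi_coeff\<close>, and inverting the change of basis recovers L Y. Off
  the carrier both maps are undefined by extensionality, so they agree as functions.\<close>

lemma corresponding_map_imp_choi_map:
  assumes e: "orthonormal_basis d e" and L: "corresponding_map d m e A L"
  shows "L = choi_map d m e A"
proof -
  let ?G = "basis_gram d e"
  from L obtain Ld where lin: "linear_superop m d L" and hs: "hs_adjoint m d L Ld"
    and A: "A = id_tensor d d m Ld (ket_bra (max_entangled_vec d e))"
    unfolding corresponding_map_def by blast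
  have LE: "L \<in> carrier_mat m m \<rightarrow>\<^sub>E carrier_mat d d" using lin by (simp add: linear_superop_def)
  have LdE: "Ld \<in> carrier_mat d d \<rightarrow>\<^sub>E carrier_mat m m"
    using hs by (simp add: hs_adjoint_def linear_superop_def)
  have "L Y = choi_map d m e A Y" if Y: "Y \<in> carrier_mat m m" for Y
  proof -
    have LY: "L Y \<in> carrier_mat d d" using LE Y by auto
    have coeff: "choi_coeff m A i j Y
        = (\<Sum>a<d. \<Sum>b<d. cnj (?G i a) * ?G j b * L Y $$ (a, b))" if ij: "i < d" "j < d" for i j
    proof -
      let ?M = "gram_ket_bra d e i j"
      have M: "?M \<in> carrier_mat d d" by (rule gram_ket_bra_carrier)
      then have LdM: "Ld ?M \<in> carrier_mat m m" using LdE by auto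
      have "mat_trace (mat_adjoint ?M * L Y) = mat_trace (mat_adjoint (Ld ?M) * Y)"
        using hs Y M by (simp add: hs_adjoint_def)
      then show ?thesis
        unfolding hs_inner_sum[OF M LY] hs_inner_sum[OF LdM Y]
        using ij e by (simp add: choi_coeff_def A index_id_tensor_max_entangled gram_ket_bra_def)
    qed
    have "L Y $$ (p, q) = (\<Sum>i<d. \<Sum>j<d. ?G i p * cnj (?G j q) * choi_coeff m A i j Y)"
      if "p < d" "q < d" for p q
    proof -
      have "(\<Sum>i<d. \<Sum>j<d. ?G i p * cnj (?G j q) * choi_coeff m A i j Y)
          = (\<Sum>i<d. \<Sum>j<d. ?G i p * cnj (?G j q) * (\<Sum>a<d. \<Sum>b<d. cnj (?G i a) * ?G j b * L Y $$ (a, b)))"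
        by (intro sum.cong refl) (simp add: coeff)
      also have "\<dots> = L Y $$ (p, q)"
        by (rule double_sum_unitary[where F = "\<lambda>a b. L Y $$ (a, b)", OF basis_gram_unitary[OF e] that])
      finally show ?thesis by simp
    qed
    then show ?thesis using LY Y by (intro eq_matI) (auto simp: choi_map_def)
  qed
  moreover have "L Y = choi_map d m e A Y" if "Y \<notin> carrier_mat m m" for Y
    using that LE by (auto simp: choi_map_def PiE_def extensional_def)
  ultimately show ?thesis by blast
qed

lemma linear_superop_choi_map: "linear_superop m d (choi_map d m e A)"
proof -
  have add: "choi_coeff m A i j (X + Y) = choi_coeff m A i j X + choi_coeff m A i j Y"
    if "X \<in> carrier_mat m m" "Y \<in> carrier_mat m m" for X Y i j
    using that by (simp add: choi_coeff_def ring_distribs sum.distrib)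
  have smult: "choi_coeff m A i j (a \<cdot>\<^sub>m X) = a * choi_coeff m A i j X"
    if "X \<in> carrier_mat m m" for X i j a
    using that by (simp add: choi_coeff_def sum_distrib_left mult_ac)
  show ?thesis unfolding linear_superop_def
  proof (intro conjI ballI allI)
    show "choi_map d m e A \<in> carrier_mat m m \<rightarrow>\<^sub>E carrier_mat d d" by (auto simp: choi_map_def)
  next
    fix X Y :: "complex mat" assume XY: "X \<in> carrier_mat m m" "Y \<in> carrier_mat m m"
    then show "choi_map d m e A (X + Y) = choi_map d m e A X + choi_map d m e A Y"
      by (intro eq_matI) (auto simp: choi_map_def add ring_distribs sum.distrib)
  next
    fix a :: complex and X :: "complex mat" assume "X \<in> carrier_mat m m"
    then show "choi_map d m e A (a \<cdot>\<^sub>m X) = a \<cdot>\<^sub>m choi_map d m e A X"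
      by (intro eq_matI) (auto simp: choi_map_def smult sum_distrib_left mult_ac)
  qed
qed

text \<open>Z is sent to the sum of <g_i|Z|g_j> times the (i, j) block of A. By orthonormality of
  the g_i, |g_k><g_l| goes to the (k, l) block, which is what the correspondence asks of the
  adjoint.\<close>

definition choi_adjoint :: "nat \<Rightarrow> nat \<Rightarrow> (nat \<Rightarrow> complex vec) \<Rightarrow> complex mat \<Rightarrow> complex mat \<Rightarrow> complex mat" where
  "choi_adjoint d m e A = (\<lambda>Z\<in>carrier_mat d d. mat m m (\<lambda>(x, y). \<Sum>i<d. \<Sum>j<d.
      (\<Sum>a<d. \<Sum>b<d. cnj (basis_gram d e i a) * basis_gram d e j b * Z $$ (a, b))
        * A $$ (i * m + x, j * m + y)))"

lemma linear_superop_choi_adjoint: "linear_superop d m (choi_adjoint d m e A)"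
  unfolding linear_superop_def
proof (intro conjI ballI allI)
  show "choi_adjoint d m e A \<in> carrier_mat d d \<rightarrow>\<^sub>E carrier_mat m m" by (auto simp: choi_adjoint_def)
next
  fix X Y :: "complex mat" assume XY: "X \<in> carrier_mat d d" "Y \<in> carrier_mat d d"
  then show "choi_adjoint d m e A (X + Y) = choi_adjoint d m e A X + choi_adjoint d m e A Y"
    by (intro eq_matI) (auto simp: choi_adjoint_def ring_distribs sum.distrib)
next
  fix a :: complex and X :: "complex mat" assume "X \<in> carrier_mat d d"
  then show "choi_adjoint d m e A (a \<cdot>\<^sub>m X) = a \<cdot>\<^sub>m choi_adjoint d m e A X"
    by (intro eq_matI) (auto simp: choi_adjoint_def sum_distrib_left sum_distrib_right mult_ac)
qed

lemma hs_adjoint_choi: "hs_adjoint m d (choi_map d m e A) (choi_adjoint d m e A)"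
  unfolding hs_adjoint_def
proof (intro conjI ballI linear_superop_choi_adjoint)
  fix Y Z :: "complex mat" assume Y: "Y \<in> carrier_mat m m" and Z: "Z \<in> carrier_mat d d"
  let ?G = "basis_gram d e"
  have LY: "choi_map d m e A Y \<in> carrier_mat d d" "choi_adjoint d m e A Z \<in> carrier_mat m m"
    using Y Z by (auto simp: choi_map_def choi_adjoint_def)
  have "mat_trace (mat_adjoint Z * choi_map d m e A Y)
      = (\<Sum>a<d. \<Sum>b<d. \<Sum>i<d. \<Sum>j<d. \<Sum>x<m. \<Sum>y<m.
          cnj (Z $$ (a, b)) * (?G i a * cnj (?G j b) * (cnj (A $$ (i * m + x, j * m + y)) * Y $$ (x, y))))"
    unfolding hs_inner_sum[OF Z LY(1)] using Y
    by (simp add: choi_map_def choi_coeff_def sum_distrib_left)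
  also have "\<dots> = (\<Sum>i<d. \<Sum>j<d. \<Sum>a<d. \<Sum>b<d. \<Sum>x<m. \<Sum>y<m.
          cnj (Z $$ (a, b)) * (?G i a * cnj (?G j b) * (cnj (A $$ (i * m + x, j * m + y)) * Y $$ (x, y))))"
    by (rule sum_swap_pairs)
  also have "\<dots> = (\<Sum>i<d. \<Sum>j<d. \<Sum>x<m. \<Sum>y<m. \<Sum>a<d. \<Sum>b<d.
          cnj (Z $$ (a, b)) * (?G i a * cnj (?G j b) * (cnj (A $$ (i * m + x, j * m + y)) * Y $$ (x, y))))"
    by (intro sum.cong refl sum_swap_pairs)
  also have "\<dots> = (\<Sum>x<m. \<Sum>y<m. \<Sum>i<d. \<Sum>j<d. \<Sum>a<d. \<Sum>b<d.
          cnj (Z $$ (a, b)) * (?G i a * cnj (?G j b) * (cnj (A $$ (i * m + x, j * m + y)) * Y $$ (x, y))))"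
    by (rule sum_swap_pairs)
  also have "\<dots> = mat_trace (mat_adjoint (choi_adjoint d m e A Z) * Y)"
    unfolding hs_inner_sum[OF LY(2) Y] using Z
    by (simp add: choi_adjoint_def sum_distrib_left sum_distrib_right mult_ac)
  finally show "mat_trace (mat_adjoint Z * choi_map d m e A Y)
    = mat_trace (mat_adjoint (choi_adjoint d m e A Z) * Y)" .
qed

lemma choi_adjoint_gram_ket_bra:
  assumes e: "orthonormal_basis d e" and "k < d" "l < d" "x < m" "y < m"
  shows "choi_adjoint d m e A (gram_ket_bra d e k l) $$ (x, y) = A $$ (k * m + x, l * m + y)"
proof -
  let ?G = "basis_gram d e"
  let ?W = "\<lambda>i j. A $$ (i * m + x, j * m + y)"
  have "choi_adjoint d m e A (gram_ket_bra d e k l) $$ (x, y)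
      = (\<Sum>i<d. \<Sum>j<d. \<Sum>a<d. \<Sum>b<d. (cnj (?G i a) * ?G j b * (?G k a * cnj (?G l b))) * ?W i j)"
    using assms gram_ket_bra_carrier[of d e k l]
    by (simp add: choi_adjoint_def gram_ket_bra_def sum_distrib_right)
  \<comment> \<open>Symmetry of G exchanges its two indices, so that the summed index comes first as
    in \<open>double_sum_unitary\<close>.\<close>
  also have "\<dots> = (\<Sum>i<d. \<Sum>j<d. \<Sum>a<d. \<Sum>b<d. ?G a k * cnj (?G b l) * (cnj (?G a i) * ?G b j * ?W i j))"
    by (intro sum.cong refl) (simp add: basis_gram_sym mult_ac)
  also have "\<dots> = (\<Sum>a<d. \<Sum>b<d. \<Sum>i<d. \<Sum>j<d. ?G a k * cnj (?G b l) * (cnj (?G a i) * ?G b j * ?W i j))"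
    by (rule sum_swap_pairs)
  also have "\<dots> = (\<Sum>a<d. \<Sum>b<d. ?G a k * cnj (?G b l) * (\<Sum>i<d. \<Sum>j<d. cnj (?G a i) * ?G b j * ?W i j))"
    by (simp add: sum_distrib_left)
  also have "\<dots> = ?W k l"
    by (rule double_sum_unitary[where F = ?W, OF basis_gram_unitary[OF e] assms(2,3)])
  finally show ?thesis .
qed

lemma corresponding_map_choi_map:
  assumes e: "orthonormal_basis d e" and A: "A \<in> carrier_mat (d * m) (d * m)"
  shows "corresponding_map d m e A (choi_map d m e A)"
  unfolding corresponding_map_def
proof (intro conjI linear_superop_choi_map exI[of _ "choi_adjoint d m e A"] hs_adjoint_choi)
  show "A = id_tensor d d m (choi_adjoint d m e A) (ket_bra (max_entangled_vec d e))" (is "A = ?B")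
  proof (rule eq_matI)
    fix I J assume "I < dim_row ?B" "J < dim_col ?B"
    then have "I < d * m" "J < d * m" by (auto simp: id_tensor_def)
    then obtain i x j y where "i < d" "x < m" "I = i * m + x" "j < d" "y < m" "J = j * m + y"
      by (metis less_mult_split)
    then show "A $$ (I, J) = ?B $$ (I, J)"
      using e by (simp add: index_id_tensor_max_entangled choi_adjoint_gram_ket_bra)
  qed (use A in \<open>auto simp: id_tensor_def\<close>)
qed

lemma corresponding_map_iff_choi_map:
  assumes "orthonormal_basis d e" "A \<in> carrier_mat (d * m) (d * m)"
  shows "corresponding_map d m e A L \<longleftrightarrow> L = choi_map d m e A"
  using corresponding_map_choi_map[OF assms] corresponding_map_imp_choi_map[OF assms(1)] by blast

text \<open>The entry \<psi>_i is <\<phi>|g_i>. The conjugate on the right comes from the conjugated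
  A in the Hilbert-Schmidt product, with Hermiticity of Q used to transpose Q; it does no harm where
  the trace is known to be nonnegative.\<close>

lemma expval_choi_map:
  assumes A: "A \<in> carrier_mat (d * m) (d * m)" and Q: "hermitian_op m Q" and \<phi>: "\<phi> \<in> carrier_vec d"
    and \<psi>: "\<psi> = vec d (\<lambda>i. \<Sum>a<d. basis_gram d e i a * cnj (\<phi> $ a))"
  shows "expval \<phi> (choi_map d m e A Q) = cnj (mat_trace (A * kron_mat (ket_bra \<psi>) Q))"
proof -
  let ?G = "basis_gram d e"
  have Qc: "Q \<in> carrier_mat m m" using Q by (simp add: hermitian_op_iff)
  have H: "cnj (Q $$ (y, x)) = Q $$ (x, y)" if "x < m" "y < m" for x y
    using Q that unfolding hermitian_op_iff by metis
  have LQ: "choi_map d m e A Q \<in> carrier_mat d d" using Qc by (auto simp: choi_map_def)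
  have \<psi>c: "\<psi> \<in> carrier_vec d" by (simp add: \<psi>)
  have "expval \<phi> (choi_map d m e A Q)
      = (\<Sum>a<d. \<Sum>b<d. \<Sum>i<d. \<Sum>j<d. (?G i a * cnj (\<phi> $ a)) * (cnj (?G j b) * \<phi> $ b) * choi_coeff m A i j Q)"
    unfolding expval_sum[OF LQ \<phi>] using Qc
    by (simp add: choi_map_def sum_distrib_left sum_distrib_right mult_ac)
  also have "\<dots> = (\<Sum>i<d. \<Sum>j<d. \<Sum>a<d. \<Sum>b<d. (?G i a * cnj (\<phi> $ a)) * (cnj (?G j b) * \<phi> $ b) * choi_coeff m A i j Q)"
    by (rule sum_swap_pairs)
  also have "\<dots> = (\<Sum>i<d. \<Sum>j<d. \<psi> $ i * cnj (\<psi> $ j) * choi_coeff m A i j Q)"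
    by (simp add: \<psi> sum_product) (simp add: sum_distrib_right)
  also have "\<dots> = (\<Sum>i<d. \<Sum>j<d. \<Sum>x<m. \<Sum>y<m.
      cnj (A $$ (i * m + x, j * m + y) * ((\<psi> $ j * cnj (\<psi> $ i)) * Q $$ (y, x))))"
    by (intro sum.cong refl) (simp add: choi_coeff_def sum_distrib_left H mult_ac)
  also have "\<dots> = (\<Sum>i<d. \<Sum>x<m. \<Sum>j<d. \<Sum>y<m.
      cnj (A $$ (i * m + x, j * m + y) * ((\<psi> $ j * cnj (\<psi> $ i)) * Q $$ (y, x))))"
    by (intro sum.cong refl sum.swap)
  also have "\<dots> = (\<Sum>i<d. \<Sum>x<m. \<Sum>j<d. \<Sum>y<m.
      cnj (A $$ (i * m + x, j * m + y) * kron_mat (ket_bra \<psi>) Q $$ (j * m + y, i * m + x)))"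
    by (intro sum.cong refl)
       (simp add: index_kron_mat[OF ket_bra_carrier[OF \<psi>c] Qc] index_ket_bra[OF \<psi>c])
  also have "\<dots> = cnj (mat_trace (A * kron_mat (ket_bra \<psi>) Q))"
    unfolding mat_trace_mult[OF A kron_mat_carrier[OF ket_bra_carrier[OF \<psi>c] Qc]]
    by (simp add: sum_lessThan_mult)
  finally show ?thesis .
qed

lemma psd_ket_bra:
  assumes "w \<in> carrier_vec n"
  shows "psd n (ket_bra w)"
  unfolding psd_def
proof (intro conjI ballI ket_bra_carrier assms)
  fix v :: "complex vec" assume v: "v \<in> carrier_vec n"
  have "expval v (ket_bra w) = cnj (v \<bullet>c w) * (v \<bullet>c w)"
    unfolding expval_sum[OF ket_bra_carrier[OF assms] v] cscalar_prod_sum[OF v assms] cnj_sum sum_product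
    using assms by (intro sum.cong refl) (simp add: index_ket_bra mult_ac)
  then show "0 \<le> expval v (ket_bra w)" using cnj_mult_self_nonneg by metis
qed

lemma hermitian_tensor_mat:
  assumes "list_all2 psd ds Rs"
  shows "hermitian_op (prod_list ds) (tensor_mat Rs)"
proof -
  have T: "tensor_mat Rs \<in> carrier_mat (prod_list ds) (prod_list ds)"
    using assms by (intro tensor_mat_carrier) (auto elim!: list_all2_mono simp: psd_def)
  from tensor_psd_ket_bra_decomp[OF assms] obtain W where
    W: "\<And>i j. i < prod_list ds \<Longrightarrow> j < prod_list ds \<Longrightarrow>
       tensor_mat Rs $$ (i, j) = (\<Sum>vs\<leftarrow>W. tensor_vec vs $ i * cnj (tensor_vec vs $ j))" by blast
  have cnj: "cnj (\<Sum>vs\<leftarrow>W. tensor_vec vs $ j * cnj (tensor_vec vs $ i))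
      = (\<Sum>vs\<leftarrow>W. tensor_vec vs $ i * cnj (tensor_vec vs $ j))" for i j
    by (induction W) auto
  show ?thesis using T by (simp add: hermitian_op_iff W cnj)
qed

lemma psd_choi_map_tensor:
  assumes bp: "block_positive (d # ds) A" and pos: "\<forall>k\<in>set (d # ds). 0 < k" and Rs: "list_all2 psd ds Rs"
  shows "psd d (choi_map d (prod_list ds) e A (tensor_mat Rs))"
  unfolding psd_def
proof (intro conjI ballI)
  let ?m = "prod_list ds"
  have T: "hermitian_op ?m (tensor_mat Rs)" by (rule hermitian_tensor_mat[OF Rs])
  then have Tc: "tensor_mat Rs \<in> carrier_mat ?m ?m" by (simp add: hermitian_op_iff)
  then show "choi_map d ?m e A (tensor_mat Rs) \<in> carrier_mat d d" by (auto simp: choi_map_def)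
  have A: "A \<in> carrier_mat (d * ?m) (d * ?m)" using bp by (simp add: block_positive_def)
  fix \<phi> :: "complex vec" assume \<phi>: "\<phi> \<in> carrier_vec d"
  define \<psi> where "\<psi> = vec d (\<lambda>i. \<Sum>a<d. basis_gram d e i a * cnj (\<phi> $ a))"
  have "\<psi> \<in> carrier_vec d" by (simp add: \<psi>_def)
  then have "list_all2 psd (d # ds) (ket_bra \<psi> # Rs)" using Rs psd_ket_bra by simp
  from block_positive_mat_trace[OF bp pos this]
  have "0 \<le> mat_trace (A * kron_mat (ket_bra \<psi>) (tensor_mat Rs))" by (simp add: tensor_mat_Cons)
  then show "0 \<le> expval \<phi> (choi_map d ?m e A (tensor_mat Rs))"
    unfolding expval_choi_map[OF A T \<phi> \<psi>_def] by (simp add: less_eq_complex_def)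
qed

text \<open>Writing \<Psi> as the sum of |i> tensor |g_i>, the left side is the sum of
  <g_i|L(X_ij)|g_j> over the blocks X_ij of X. Each term is the Hilbert-Schmidt product of the (i,
  j) block of A with X_ij, so the total is the trace of A^* X, and A is Hermitian.\<close>

lemma expval_id_tensor_choi_map:
  assumes e: "orthonormal_basis d e" and A: "hermitian_op (d * m) A" and X: "X \<in> carrier_mat (d * m) (d * m)"
  shows "expval (max_entangled_vec d e) (id_tensor d m d (choi_map d m e A) X) = mat_trace (A * X)"
proof -
  let ?G = "basis_gram d e" and ?I = "id_tensor d m d (choi_map d m e A) X"
  define B where "B i j = mat m m (\<lambda>(x, y). X $$ (i * m + x, j * m + y))" for i j
  have B: "B i j \<in> carrier_mat m m" for i j by (simp add: B_def)
  have Ac: "A \<in> carrier_mat (d * m) (d * m)" using A by (simp add: hermitian_op_def)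
  have I: "?I \<in> carrier_mat (d * d) (d * d)" by (simp add: id_tensor_def)
  have Iij: "?I $$ (i * d + a, j * d + b) = (\<Sum>k<d. \<Sum>l<d. ?G k a * cnj (?G l b) * choi_coeff m A k l (B i j))"
    if "i < d" "a < d" "j < d" "b < d" for i a j b
  proof -
    have "?I $$ (i * d + a, j * d + b) = choi_map d m e A (B i j) $$ (a, b)"
      using that by (simp add: id_tensor_def mult_add_less_mult B_def)
    then show ?thesis using that B by (simp add: choi_map_def)
  qed
  \<comment> \<open>The weights carry the conjugates of G here, so \<open>double_sum_unitary\<close>
    is applied to the conjugate matrix, which is unitary as well.\<close>
  have U: "(\<Sum>a<d. cnj (?G a i) * cnj (cnj (?G a j))) = (if i = j then 1 else 0)" if "i < d" "j < d" for i j
    using basis_gram_unitary[OF e that(2,1)] by (cases "i = j") (simp_all add: mult.commute)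
  have coeff: "(\<Sum>a<d. \<Sum>b<d. cnj (?G a i) * cnj (cnj (?G b j)) *
       (\<Sum>k<d. \<Sum>l<d. cnj (cnj (?G a k)) * cnj (?G b l) * choi_coeff m A k l (B i j)))
      = choi_coeff m A i j (B i j)" if "i < d" "j < d" for i j
    by (rule double_sum_unitary[where F = "\<lambda>k l. choi_coeff m A k l (B i j)" and U = "\<lambda>a i. cnj (?G a i)", OF U that])
  have "expval (max_entangled_vec d e) ?I = (\<Sum>i<d. \<Sum>a<d. \<Sum>j<d. \<Sum>b<d.
      cnj (?G a i) * (\<Sum>k<d. \<Sum>l<d. ?G a k * cnj (?G b l) * choi_coeff m A k l (B i j)) * ?G b j)"
    unfolding expval_sum[OF I max_entangled_vec_carrier] sum_lessThan_mult
    by (intro sum.cong refl)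
       (simp add: Iij index_max_entangled_vec[OF e] basis_gram_sym)
  also have "\<dots> = (\<Sum>i<d. \<Sum>j<d. \<Sum>a<d. \<Sum>b<d.
      cnj (?G a i) * (\<Sum>k<d. \<Sum>l<d. ?G a k * cnj (?G b l) * choi_coeff m A k l (B i j)) * ?G b j)"
    by (intro sum.cong refl sum.swap)
  also have "\<dots> = (\<Sum>i<d. \<Sum>j<d. choi_coeff m A i j (B i j))"
    by (intro sum.cong refl) (simp add: coeff[symmetric] mult_ac)
  also have "\<dots> = (\<Sum>i<d. \<Sum>j<d. \<Sum>x<m. \<Sum>y<m. cnj (A $$ (i * m + x, j * m + y)) * X $$ (i * m + x, j * m + y))"
    by (simp add: choi_coeff_def B_def)
  also have "\<dots> = (\<Sum>i<d. \<Sum>x<m. \<Sum>j<d. \<Sum>y<m. cnj (A $$ (i * m + x, j * m + y)) * X $$ (i * m + x, j * m + y))"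
    by (intro sum.cong refl sum.swap)
  also have "\<dots> = mat_trace (mat_adjoint A * X)"
    unfolding hs_inner_sum[OF Ac X] by (simp add: sum_lessThan_mult)
  finally show ?thesis using A by (simp add: hermitian_op_def)
qed

subsection \<open>Unextendible product bases and witnesses\<close>

text \<open>The minimum for the negative of A, written as \<open>0 - 1 A\<close> so that the rule
  for \<open>expval\<close> of a difference covers it.\<close>

lemma Re_expval_product_attains_max:
  assumes A: "A \<in> carrier_mat (prod_list ds) (prod_list ds)" and ex: "list_all2 unit_vector ds ws"
  shows "\<exists>vs. list_all2 unit_vector ds vs \<and>
    (\<forall>us. list_all2 unit_vector ds us \<longrightarrow> Re (expval (tensor_vec us) A) \<le> Re (expval (tensor_vec vs) A))"
proof -
  let ?N = "prod_list ds"
  have neg: "expval (tensor_vec us) (0\<^sub>m ?N ?N - 1 \<cdot>\<^sub>m A) = - expval (tensor_vec us) A"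
    if "list_all2 unit_vector ds us" for us
    using unit_vectors_tensor_carrier[OF that] A
    by (simp add: expval_minus_smult[of _ ?N]) (simp add: expval_sum[of _ ?N])
  have "0\<^sub>m ?N ?N - 1 \<cdot>\<^sub>m A \<in> carrier_mat ?N ?N" using A by auto
  from Re_expval_product_attains_min[OF this ex] show ?thesis by (auto simp: neg)
qed

lemma mat_trace_smult: "X \<in> carrier_mat n n \<Longrightarrow> mat_trace (a \<cdot>\<^sub>m X) = a * mat_trace X"
  by (simp add: mat_trace_def sum_distrib_left)

lemma mat_trace_minus_smult_mult:
  assumes "A \<in> carrier_mat n n" "B \<in> carrier_mat n n" "X \<in> carrier_mat n n"
  shows "mat_trace ((A - a \<cdot>\<^sub>m B) * X) = mat_trace (A * X) - a * mat_trace (B * X)"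
proof -
  have "A - a \<cdot>\<^sub>m B \<in> carrier_mat n n" using assms by auto
  then show ?thesis using assms
    by (simp add: mat_trace_mult[of _ n n] sum_distrib_left flip: sum_subtractf)
       (auto simp: algebra_simps intro!: sum.cong)
qed

lemma psd_smult:
  assumes "psd n X" "0 \<le> a"
  shows "psd n (a \<cdot>\<^sub>m X)"
proof -
  have X: "X \<in> carrier_mat n n" using assms by (simp add: psd_def)
  have "expval v (a \<cdot>\<^sub>m X) = a * expval v X" if "v \<in> carrier_vec n" for v
    using that X by (simp add: expval_sum[of _ n] sum_distrib_left mult_ac)
  then show ?thesis using assms X by (auto simp: psd_def)
qed

text \<open>Diagonal entries are values of the form at the standard basis vectors. If they add up to
  0, the form vanishes at each of these vectors, so X annihilates all of them.\<close>

lemma psd_mat_trace: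
  assumes "psd n X"
  shows "0 \<le> mat_trace X" and "mat_trace X = 0 \<Longrightarrow> X = 0\<^sub>m n n"
proof -
  have X: "X \<in> carrier_mat n n" using assms by (simp add: psd_def)
  have dg: "0 \<le> X $$ (i, i)" if "i < n" for i
    using assms that by (auto simp: psd_def simp flip: expval_unit_vec[OF X])
  show "0 \<le> mat_trace X" unfolding mat_trace_def using dg X by (intro sum_nonneg) auto
  assume "mat_trace X = 0"
  then have "X $$ (i, i) = 0" if "i < n" for i
    unfolding mat_trace_def using dg X that by (subst (asm) sum_nonneg_eq_0_iff) auto
  then have z: "X *\<^sub>v unit_vec n i = 0\<^sub>v n" if "i < n" for i
    using that by (intro psd_expval_eq_0[OF assms]) (auto simp: expval_unit_vec[OF X])
  have "X $$ (k, i) = 0" if "k < n" "i < n" for k i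
    using mult_smult_unit_vec[OF X that(2,1), of 1] z[OF that(2)] that by simp
  then show "X = 0\<^sub>m n n" using X by (intro eq_matI) auto
qed

lemma kron_mat_one: "kron_mat (1\<^sub>m d) (1\<^sub>m m) = 1\<^sub>m (d * m)"
proof (rule eq_matI)
  fix i j assume "i < dim_row (1\<^sub>m (d * m) :: complex mat)" "j < dim_col (1\<^sub>m (d * m) :: complex mat)"
  then have ij: "i < d * m" "j < d * m" by auto
  from ij(1) obtain a b where a: "a < d" "b < m" "i = a * m + b" by (rule less_mult_split)
  from ij(2) obtain a' b' where b: "a' < d" "b' < m" "j = a' * m + b'" by (rule less_mult_split)
  have "i div m = a" "i mod m = b" "j div m = a'" "j mod m = b'" using a b by auto
  then have "i = j \<longleftrightarrow> a = a' \<and> b = b'" using a(3) b(3) by metis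
  moreover have "kron_mat (1\<^sub>m d) (1\<^sub>m m) $$ (i, j) = 1\<^sub>m d $$ (a, a') * (1\<^sub>m m :: complex mat) $$ (b, b')"
    unfolding a b by (rule index_kron_mat) (use a b in auto)
  ultimately show "kron_mat (1\<^sub>m d) (1\<^sub>m m) $$ (i, j) = 1\<^sub>m (d * m) $$ (i, j)"
    using a(1,2) b(1,2) ij by simp
qed (auto simp: kron_mat_def)

lemma tensor_mat_one: "tensor_mat (map (\<lambda>d. 1\<^sub>m d) ds) = 1\<^sub>m (prod_list ds)"
  by (induction ds) (simp_all add: tensor_mat_Cons kron_mat_one, simp add: tensor_mat_def)

lemma psd_one: "psd n (1\<^sub>m n)"
  by (auto simp: psd_def expval_one cscalar_prod_self_nonneg)

text \<open>
  \<open>- C\<close> is nonnegative on product vectors, hence also against the identity, which is a tensor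
  product of positive operators; so \<open>Tr C \<le> 0\<close>.
\<close>
lemma psd_eq_zero_if_product_expval_nonpos:
  assumes "psd (prod_list ds) C" "\<forall>d\<in>set ds. 0 < d"
    and le: "\<And>vs. list_all2 unit_vector ds vs \<Longrightarrow> Re (expval (tensor_vec vs) C) \<le> 0"
  shows "C = 0\<^sub>m (prod_list ds) (prod_list ds)"
proof -
  let ?N = "prod_list ds" and ?B = "0\<^sub>m (prod_list ds) (prod_list ds) - 1 \<cdot>\<^sub>m C"
  have C: "C \<in> carrier_mat ?N ?N" using assms(1) by (simp add: psd_def)
  have "block_positive ds ?B" unfolding block_positive_def
  proof (intro conjI allI impI)
    fix vs assume vs: "list_all2 unit_vector ds vs"
    have t: "tensor_vec vs \<in> carrier_vec ?N" by (rule unit_vectors_tensor_carrier[OF vs])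
    have "0 \<le> expval (tensor_vec vs) C" using assms(1) t by (simp add: psd_def)
    moreover have "expval (tensor_vec vs) (0\<^sub>m ?N ?N) = 0" using t by (simp add: expval_sum[of _ ?N])
    ultimately show "0 \<le> expval (tensor_vec vs) ?B"
      using le[OF vs] C t by (auto simp: expval_minus_smult[of _ ?N] less_eq_complex_def)
  qed (use C in auto)
  moreover have "list_all2 psd ds (map (\<lambda>d. 1\<^sub>m d) ds)" by (simp add: list_all2_map2 list_all2_same psd_one)
  ultimately have "0 \<le> mat_trace (?B * 1\<^sub>m ?N)"
    using block_positive_mat_trace[OF _ assms(2)] by (metis tensor_mat_one)
  also have "mat_trace (?B * 1\<^sub>m ?N) = mat_trace (0\<^sub>m ?N ?N * 1\<^sub>m ?N) - mat_trace (C * 1\<^sub>m ?N)"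
    using C by (simp only: mat_trace_minus_smult_mult[of _ ?N] zero_carrier_mat one_carrier_mat) simp
  also have "\<dots> = - mat_trace C" using C by (simp add: mat_trace_def)
  finally have "mat_trace C = 0" using psd_mat_trace(1)[OF assms(1)]
    by (simp add: less_eq_complex_def complex_eq_iff)
  then show ?thesis by (rule psd_mat_trace(2)[OF assms(1)])
qed

section \<open>Consequences of unextendibility\<close>

lemma product_vector_carrier:
  "product_vector ds v \<Longrightarrow> v \<in> carrier_vec (prod_list ds)"
  unfolding product_vector_def
  by (auto intro!: tensor_vec_carrier elim!: list_all2_mono)

lemma product_vector_unit_vectors:
  assumes "list_all2 unit_vector ds vs"
  shows "product_vector ds (tensor_vec vs)"
proof -
  have "list_all2 (\<lambda>d u. u \<in> carrier_vec d \<and> u \<noteq> 0\<^sub>v d) ds vs"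
    using assms by (rule list_all2_mono) (auto simp: unit_vector_def)
  then show ?thesis unfolding product_vector_def by blast
qed

text \<open>With a factor of dimension 0 the whole space would consist of one vector. The range of
  P, which is the span of S, would then be everything, against the second condition on S.\<close>

lemma unextendible_product_basis_dims_pos:
  assumes "unextendible_product_basis ds S"
    and "orth_projector_onto (prod_list ds) (vec_span (prod_list ds) S) P"
  shows "\<forall>d\<in>set ds. 0 < d"
proof (rule ccontr)
  assume "\<not> ?thesis"
  then have N: "prod_list ds = 0" by auto
  have one: "v = w" if "v \<in> carrier_vec 0" "w \<in> carrier_vec 0" for v w :: "complex vec"
    using that by (intro eq_vecI) auto
  have W: "vec_span 0 S = (\<lambda>v. P *\<^sub>v v) ` carrier_vec 0" and P: "P \<in> carrier_mat 0 0"
    using assms(2) by (auto simp: orth_projector_onto_def N orth_projector_def hermitian_op_def)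
  have "P *\<^sub>v v = v" if "v \<in> carrier_vec 0" for v by (rule one) (use that P in auto)
  then have "vec_span 0 S = carrier_vec 0" unfolding W by (simp cong: image_cong_simp)
  with assms(1) N show False by (simp add: unextendible_product_basis_def)
qed

lemma orth_projector_complement:
  assumes "orth_projector n P"
  shows "orth_projector n (1\<^sub>m n - P)" and "P * (1\<^sub>m n - P) = 0\<^sub>m n n"
proof -
  have P: "P \<in> carrier_mat n n" "hermitian_op n P" "P * P = P"
    using assms by (auto simp: orth_projector_def hermitian_op_def)
  have "P * (1\<^sub>m n - P) = P * 1\<^sub>m n - P * P"
    using P(1) by (intro mult_minus_distrib_mat) auto
  then show 0: "P * (1\<^sub>m n - P) = 0\<^sub>m n n" using P by simp
  have "(1\<^sub>m n - P) * (1\<^sub>m n - P) = 1\<^sub>m n * (1\<^sub>m n - P) - P * (1\<^sub>m n - P)"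
    using P(1) by (intro minus_mult_distrib_mat) auto
  also have "\<dots> = 1\<^sub>m n - P" unfolding 0 using P(1) by (intro eq_matI) auto
  finally have "(1\<^sub>m n - P) * (1\<^sub>m n - P) = 1\<^sub>m n - P" .
  moreover have "hermitian_op n (1\<^sub>m n - P)" unfolding hermitian_op_iff
  proof (intro conjI allI impI)
    fix i j assume ij: "i < n" "j < n"
    then have "P $$ (i, j) = cnj (P $$ (j, i))" using P(2) unfolding hermitian_op_iff by blast
    with ij P(1) show "(1\<^sub>m n - P) $$ (i, j) = cnj ((1\<^sub>m n - P) $$ (j, i))" by simp
  qed (use P(1) in auto)
  ultimately show "orth_projector n (1\<^sub>m n - P)" by (simp add: orth_projector_def)
qed

lemma hermitian_minus_real_smult:
  assumes "hermitian_op n A" "hermitian_op n B"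
  shows "hermitian_op n (A - complex_of_real a \<cdot>\<^sub>m B)"
  unfolding hermitian_op_iff
proof (intro conjI allI impI)
  have AB: "A \<in> carrier_mat n n" "B \<in> carrier_mat n n" using assms by (auto simp: hermitian_op_def)
  then show "A - complex_of_real a \<cdot>\<^sub>m B \<in> carrier_mat n n" by auto
  fix i j assume ij: "i < n" "j < n"
  then have "A $$ (i, j) = cnj (A $$ (j, i))" "B $$ (i, j) = cnj (B $$ (j, i))"
    using assms unfolding hermitian_op_iff by blast+
  then show "(A - complex_of_real a \<cdot>\<^sub>m B) $$ (i, j) = cnj ((A - complex_of_real a \<cdot>\<^sub>m B) $$ (j, i))"
    using ij AB by simp
qed

lemma unextendible_product_basis_projector_expval_pos:
  assumes upb: "unextendible_product_basis ds S"
    and P: "orth_projector_onto (prod_list ds) (vec_span (prod_list ds) S) P"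
    and vs: "list_all2 unit_vector ds vs"
  shows "0 < expval (tensor_vec vs) P"
proof -
  let ?N = "prod_list ds" and ?t = "tensor_vec vs"
  interpret vec_space "TYPE(complex)" ?N .
  have oP: "orth_projector ?N P" and im: "(\<lambda>v. P *\<^sub>v v) ` carrier_vec ?N = vec_span ?N S"
    using P by (auto simp: orth_projector_onto_def)
  have t: "?t \<in> carrier_vec ?N" by (rule unit_vectors_tensor_carrier[OF vs])
  have S: "S \<subseteq> carrier_vec ?N"
    using upb product_vector_carrier by (auto simp: unextendible_product_basis_def)
  have "expval ?t P \<noteq> 0"
  proof
    assume "expval ?t P = 0"
    then have Pt: "P *\<^sub>v ?t = 0\<^sub>v ?N" by (rule psd_expval_eq_0[OF orth_projector_psd[OF oP] t])
    have "?t \<bullet>c w = 0" if w: "w \<in> S" for w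
    proof -
      have "w \<in> vec_span ?N S" unfolding vec_span_def using span_mem[OF _ w] S by simp
      \<comment> \<open>Elements of S lie in the range of P, so P moves across the inner product
        onto the product vector, which it annihilates.\<close>
      then obtain u where u: "u \<in> carrier_vec ?N" "w = P *\<^sub>v u" unfolding im[symmetric] by blast
      have "?t \<bullet>c w = (P *\<^sub>v ?t) \<bullet>c u"
        unfolding u(2) using oP t u(1) by (simp add: hermitian_cscalar_prod[of ?N P ?t u] orth_projector_def)
      also have "\<dots> = 0" using u(1) by (simp add: Pt)
      finally show ?thesis .
    qed
    with upb product_vector_unit_vectors[OF vs] show False
      unfolding unextendible_product_basis_def by blast
  qed
  moreover have "0 \<le> expval ?t P" using orth_projector_psd[OF oP] t by (simp add: psd_def)
  ultimately show ?thesis by simp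
qed

text \<open>Because Tr (P \<rho>) = 0, the mean value of A in \<rho> is -(\<epsilon>/c) Tr (C
  \<rho>). The exact value -\<epsilon>/c thus belongs to the normalisation Tr (C \<rho>) = 1, and
  strict negativity to Tr (Pperp C) > 0: if this trace is 0, the mean value is 0 and nothing is
  detected.\<close>

theorem mainTheorem3:
  fixes d :: nat and ds :: "nat list"
    and e :: "nat \<Rightarrow> complex vec"
    and S :: "complex vec set"
    and P Pperp \<rho> C A :: "complex mat"
    and \<epsilon> c :: real
  assumes "orthonormal_basis d e"
    and "unextendible_product_basis (d # ds) S"
    and "orth_projector_onto (prod_list (d # ds)) (vec_span (prod_list (d # ds)) S) P"
    and "Pperp = 1\<^sub>m (prod_list (d # ds)) - P"
    and "\<rho> = (1 / mat_trace Pperp) \<cdot>\<^sub>m Pperp"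
    and "positive_op (prod_list (d # ds)) C"
    and "0 \<le> mat_trace (Pperp * C)"
    and "\<epsilon> = Inf (product_values (d # ds) P)"
    and "c = Sup (product_values (d # ds) C)"
    and "A = P - complex_of_real (\<epsilon> / c) \<cdot>\<^sub>m C"
  shows
    "\<epsilon> \<in> product_values (d # ds) P \<and> (\<forall>x\<in>product_values (d # ds) P. \<epsilon> \<le> x) \<and>
     c \<in> product_values (d # ds) C \<and> (\<forall>x\<in>product_values (d # ds) C. x \<le> c) \<and>

     (\<forall>Ps. list_all2 rank1_projector (d # ds) Ps \<longrightarrow> 0 \<le> mat_trace (A * tensor_mat Ps)) \<and>
     mat_trace (A * \<rho>) = - complex_of_real (\<epsilon> / c) * mat_trace (C * \<rho>) \<and>
     (mat_trace (C * \<rho>) = 1 \<longrightarrow> mat_trace (A * \<rho>) = - complex_of_real (\<epsilon> / c)) \<and>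
     (0 < mat_trace (Pperp * C) \<longrightarrow>
        - (\<epsilon> / c) < 0 \<and> mat_trace (A * \<rho>) < 0 \<and> entanglement_witness_for (d # ds) A \<rho>) \<and>

     (\<exists>!L. corresponding_map d (prod_list ds) e A L) \<and>
     (\<forall>L. corresponding_map d (prod_list ds) e A L \<longrightarrow>
        (\<forall>Ps. list_all2 orth_projector ds Ps \<longrightarrow> positive_op d (L (tensor_mat Ps))) \<and>
        expval (max_entangled_vec d e) (id_tensor d (prod_list ds) d L \<rho>) = mat_trace (A * \<rho>) \<and>
        (0 < mat_trace (Pperp * C) \<longrightarrow>
           expval (max_entangled_vec d e) (id_tensor d (prod_list ds) d L \<rho>) < 0 \<and>
           entangled (d # ds) \<rho>))"
proof -
  let ?D = "d # ds" and ?m = "prod_list ds"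
  define N where "N = prod_list ?D"
  have N: "N = d * ?m" by (simp add: N_def)
  have oP: "orth_projector N P" and im: "(\<lambda>v. P *\<^sub>v v) ` carrier_vec N = vec_span N S"
    using assms(3) by (auto simp: orth_projector_onto_def N_def)
  have dims: "\<forall>k\<in>set ?D. 0 < k"
    by (rule unextendible_product_basis_dims_pos[OF assms(2,3)])
  have Pc: "P \<in> carrier_mat N N" by (rule orth_projector_carrier[OF oP])
  have psdC: "psd N C" using assms(6) by (simp add: positive_op_iff_psd N_def)
  then have Cc: "C \<in> carrier_mat N N" by (simp add: psd_def)
  have herm: "hermitian_op N A" unfolding assms(10)
    using oP psd_hermitian[OF psdC] by (intro hermitian_minus_real_smult) (auto simp: orth_projector_def)
  then have Ac: "A \<in> carrier_mat N N" by (simp add: hermitian_op_def)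
  have Q: "orth_projector N Pperp" "P * Pperp = 0\<^sub>m N N"
    using orth_projector_complement[OF oP] by (auto simp: assms(4) N_def)
  then have Qc: "Pperp \<in> carrier_mat N N" and psdQ: "psd N Pperp"
    by (auto intro: orth_projector_carrier orth_projector_psd)

  \<comment> \<open>Positive dimensions provide a unit product vector, so both extremal problems
    range over nonempty sets.\<close>
  have ex: "list_all2 unit_vector ?D (map (\<lambda>k. unit_vec k 0) ?D)"
    using dims by (auto simp: list_all2_map2 list_all2_same unit_vector_unit_vec)
  from Re_expval_product_attains_min[OF Pc[unfolded N_def] ex] obtain vs where
    vs: "list_all2 unit_vector ?D vs" and
    vs_min: "\<And>us. list_all2 unit_vector ?D us \<Longrightarrow> Re (expval (tensor_vec vs) P) \<le> Re (expval (tensor_vec us) P)"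
    by blast
  from Re_expval_product_attains_max[OF Cc[unfolded N_def] ex] obtain ws where
    ws: "list_all2 unit_vector ?D ws" and
    ws_max: "\<And>us. list_all2 unit_vector ?D us \<Longrightarrow> Re (expval (tensor_vec us) C) \<le> Re (expval (tensor_vec ws) C)"
    by blast
  note pvP = product_values_eq[OF Pc[unfolded N_def]] and pvC = product_values_eq[OF Cc[unfolded N_def]]
  have eps: "\<epsilon> = Re (expval (tensor_vec vs) P)"
    unfolding assms(8) pvP using vs vs_min by (intro cInf_eq_minimum) auto
  have c: "c = Re (expval (tensor_vec ws) C)"
    unfolding assms(9) pvC using ws ws_max by (intro cSup_eq_maximum) auto
  have eps_mem: "\<epsilon> \<in> product_values ?D P" unfolding pvP eps using vs by blast
  have eps_le: "\<forall>x\<in>product_values ?D P. \<epsilon> \<le> x" unfolding pvP eps using vs_min by blast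
  have c_mem: "c \<in> product_values ?D C" unfolding pvC c using ws by blast
  have c_ge: "\<forall>x\<in>product_values ?D C. x \<le> c" unfolding pvC c using ws_max by blast

  have eps_pos: "0 < \<epsilon>"
    using unextendible_product_basis_projector_expval_pos[OF assms(2,3) vs]
    by (simp add: eps less_complex_def)
  have tc: "tensor_vec us \<in> carrier_vec N" if "list_all2 unit_vector ?D us" for us
    using unit_vectors_tensor_carrier[OF that] by (simp add: N_def)
  have c_nonneg: "0 \<le> c" using psdC tc[OF ws] by (auto simp: c psd_def less_eq_complex_def)

  have bp: "block_positive ?D A"
    unfolding block_positive_def
  proof (intro conjI allI impI)
    show "A \<in> carrier_mat (prod_list ?D) (prod_list ?D)" using Ac by (simp add: N_def)
    fix us assume us: "list_all2 unit_vector ?D us"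
    have e: "expval (tensor_vec us) A = expval (tensor_vec us) P - of_real (\<epsilon> / c) * expval (tensor_vec us) C"
      unfolding assms(10) by (rule expval_minus_smult[OF Pc Cc tc[OF us]])
    have "\<epsilon> / c * Re (expval (tensor_vec us) C) \<le> \<epsilon> / c * c"
      using eps_pos c_nonneg ws_max[OF us] by (intro mult_left_mono) (auto simp: c)
    \<comment> \<open>Equality if c is nonzero; for c = 0 the left side is 0.\<close>
    also have "\<dots> \<le> \<epsilon>" using eps_pos by simp
    also have "\<dots> \<le> Re (expval (tensor_vec us) P)" using vs_min[OF us] by (simp add: eps)
    finally have "0 \<le> Re (expval (tensor_vec us) A)" by (simp add: e)
    then show "0 \<le> expval (tensor_vec us) A"
      using hermitian_expval_real[OF herm tc[OF us]] by (simp add: less_eq_complex_def)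
  qed
  have prodpos: "\<forall>Ps. list_all2 rank1_projector ?D Ps \<longrightarrow> 0 \<le> mat_trace (A * tensor_mat Ps)"
  proof (intro allI impI)
    fix Ps assume "list_all2 rank1_projector ?D Ps"
    then have "list_all2 psd ?D Ps"
      by (rule list_all2_mono) (auto simp: rank1_projector_def orth_projector_psd)
    then show "0 \<le> mat_trace (A * tensor_mat Ps)" by (rule block_positive_mat_trace[OF bp dims])
  qed

  \<comment> \<open>This makes the normalising trace of \<rho> nonzero: P would otherwise be the
    identity and S would span the space.\<close>
  have "Pperp \<noteq> 0\<^sub>m N N"
  proof
    assume z: "Pperp = 0\<^sub>m N N"
    have "P = 1\<^sub>m N"
    proof (rule eq_matI)
      fix i j assume "i < dim_row (1\<^sub>m N :: complex mat)" "j < dim_col (1\<^sub>m N :: complex mat)"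
      then have ij: "i < N" "j < N" by auto
      have "(1\<^sub>m N - P) $$ (i, j) = 0" using z ij by (simp add: assms(4) N_def)
      with ij Pc show "P $$ (i, j) = 1\<^sub>m N $$ (i, j)" by simp
    qed (use Pc in auto)
    then have "vec_span N S = carrier_vec N" using im by (auto simp: image_def)
    with assms(2) show False by (simp add: unextendible_product_basis_def N_def)
  qed
  with psd_mat_trace[OF psdQ] have trQ: "0 < mat_trace Pperp" by (auto simp: order_le_less)
  then have trQ0: "0 \<le> 1 / mat_trace Pperp" "mat_trace Pperp \<noteq> 0"
    by (auto simp: less_complex_def less_eq_complex_def Re_divide Im_divide)
  have \<rho>c: "\<rho> \<in> carrier_mat N N" using Qc by (simp add: assms(5))
  have dens: "density_op (prod_list ?D) \<rho>"
    using psd_smult[OF psdQ trQ0(1)] trQ0(2) Qc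
    by (simp add: density_op_def positive_op_iff_psd assms(5) N mat_trace_smult)
  have mult_\<rho>: "mat_trace (X * \<rho>) = mat_trace (X * Pperp) / mat_trace Pperp" if "X \<in> carrier_mat N N" for X
    using that Qc by (simp add: assms(5) mult_smult_distrib[of _ N N _ N] mat_trace_smult[of _ N])
  have "mat_trace (P * \<rho>) = 0"
    unfolding mult_\<rho>[OF Pc] Q(2) by (simp add: mat_trace_def)
  then have A\<rho>: "mat_trace (A * \<rho>) = - complex_of_real (\<epsilon> / c) * mat_trace (C * \<rho>)"
    unfolding assms(10) by (simp add: mat_trace_minus_smult_mult[OF Pc Cc \<rho>c])

  have strict: "- (\<epsilon> / c) < 0 \<and> mat_trace (A * \<rho>) < 0" if pos: "0 < mat_trace (Pperp * C)"
  proof -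
    \<comment> \<open>As c is the largest value of C on product vectors, c = 0 would give C = 0 and
      contradict the positive trace.\<close>
    have "c \<noteq> 0"
    proof
      assume "c = 0"
      then have "C = 0\<^sub>m N N" unfolding N_def
        using psdC dims ws_max by (intro psd_eq_zero_if_product_expval_nonpos) (auto simp: N_def c)
      with pos Qc show False by (simp add: mat_trace_def)
    qed
    with c_nonneg eps_pos have r: "0 < \<epsilon> / c" by simp
    have t: "0 < mat_trace (C * \<rho>)"
      using pos trQ unfolding mult_\<rho>[OF Cc] mat_trace_comm[OF Cc Qc]
      by (auto simp: less_complex_def Re_divide Im_divide)
    then have "0 < \<epsilon> / c * Re (mat_trace (C * \<rho>))"
      by (intro mult_pos_pos[OF r]) (simp add: less_complex_def)
    with r t show ?thesis by (auto simp: A\<rho> less_complex_def)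
  qed
  have wit: "entanglement_witness ?D A"
    using herm block_positive_separable[OF bp dims] by (simp add: entanglement_witness_def N_def)

  have map_iff: "corresponding_map d ?m e A L \<longleftrightarrow> L = choi_map d ?m e A" for L
    using corresponding_map_iff_choi_map[OF assms(1) Ac[unfolded N]] .
  have pos_map: "positive_op d (choi_map d ?m e A (tensor_mat Ps))" if "list_all2 orth_projector ds Ps" for Ps
  proof -
    have "list_all2 psd ds Ps" using that by (rule list_all2_mono) (rule orth_projector_psd)
    then show ?thesis unfolding positive_op_iff_psd by (rule psd_choi_map_tensor[OF bp dims])
  qed
  have ev: "expval (max_entangled_vec d e) (id_tensor d ?m d (choi_map d ?m e A) \<rho>) = mat_trace (A * \<rho>)"
    using herm \<rho>c unfolding N by (rule expval_id_tensor_choi_map[OF assms(1)])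
  \<comment> \<open>A is nonnegative on every separable state, so its negative mean value rules out
    separability of \<rho>.\<close>
  have ent: "entangled ?D \<rho>" if "0 < mat_trace (Pperp * C)"
    using strict[OF that] dens wit by (auto simp: entangled_def entanglement_witness_def)

  show ?thesis
    using eps_mem eps_le c_mem c_ge prodpos A\<rho> strict wit dens ent pos_map ev
    unfolding map_iff entanglement_witness_for_def by simp
qed

end
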